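(* Let $n\ge 1$, $N=\binom{n}{2}$, and let $\ell$ be an integer with $0 \le \ell \le N-\ell$. Let $\widetilde{M}^{(\ell)} = M_{\ell+1}M_{\ell+2}\cdots M_{N-\ell}$ (a square matrix with rows indexed by $\mathcal{S}_n(\ell)$ and columns indexed by $\mathcal{S}_n(N-\ell)$; for $\ell = N-\ell$ it is the identity). Then, for any fixed orderings of the index sets, \[ \det \widetilde{M}^{(\ell)} = \pm \prod_{k=0}^{\ell} \Big( (\ell-k+1)(\ell-k+2)\cdots(N-\ell-k) \Big)^{|\mathcal{S}_n(k)| - |\mathcal{S}_n(k-1)|}, \] with the convention $|\mathcal{S}_n(-1)| = 0$.
   Context: $\mathcal{S}_n$ is the symmetric group with generating set $S=\{s_1,\ldots,s_{n-1}\}$ of simple transpositions $s_i=(i\ i{+}1)$; $\ell(w)$ is Coxeter length and $\mathcal{S}_n(m)$ is the set of permutations of length $m$. For $1\le m\le N$, $M_m$ is the matrix with rows indexed by $\mathcal{S}_n(m-1)$ and columns indexed by $\mathcal{S}_n(m)$ whose $(u,v)$ entry is $k$ if $v = u s_k$, and $0$ if $u^{-1}v\notin S$. The sign $\pm$ reflects that no ordering of rows and columns is specified. *)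

theory Defs
  imports "Jordan_Normal_Form.Determinant" "HOL-Combinatorics.Permutations"
begin

text \<open>The symmetric group on n letters is rendered as the set of functions permuting \<open>{1..n}\<close>,
  with function composition as product.\<close>

definition simple_transp :: "nat \<Rightarrow> nat \<Rightarrow> nat" where
  "simple_transp i = Transposition.transpose i (Suc i)"

definition word_prod :: "nat list \<Rightarrow> nat \<Rightarrow> nat" where
  "word_prod ks = foldr (\<lambda>k w. simple_transp k \<circ> w) ks id"

definition coxeter_length :: "nat \<Rightarrow> (nat \<Rightarrow> nat) \<Rightarrow> nat" where
  "coxeter_length n w =
     (LEAST r. \<exists>ks. length ks = r \<and> set ks \<subseteq> {1..<n} \<and> word_prod ks = w)"

definition perms_of_length :: "nat \<Rightarrow> nat \<Rightarrow> (nat \<Rightarrow> nat) set" where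
  "perms_of_length n m = {w. w permutes {1..n} \<and> coxeter_length n w = m}"

definition weak_order_entry :: "nat \<Rightarrow> (nat \<Rightarrow> nat) \<Rightarrow> (nat \<Rightarrow> nat) \<Rightarrow> rat" where
  "weak_order_entry n u v =
     (if \<exists>k\<in>{1..<n}. v = u \<circ> simple_transp k
      then of_nat (THE k. k \<in> {1..<n} \<and> v = u \<circ> simple_transp k)
      else 0)"

text \<open>The list \<open>e m\<close> is an ordering of the permutations of length m; it orders the columns of
  the m-th matrix and the rows of the next one.\<close>

definition weak_order_mat :: "nat \<Rightarrow> (nat \<Rightarrow> (nat \<Rightarrow> nat) list) \<Rightarrow> nat \<Rightarrow> rat mat" where
  "weak_order_mat n e m =
     mat (length (e (m - 1))) (length (e m)) (\<lambda>(i, j). weak_order_entry n (e (m - 1) ! i) (e m ! j))"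

text \<open>The product of the matrices with indices \<open>l + 1, \<dots>, N - l\<close> in this order, where
  \<open>N = n choose 2\<close>. The final identity factor only serves to cover the empty product.\<close>

definition weak_order_prod_mat :: "nat \<Rightarrow> (nat \<Rightarrow> (nat \<Rightarrow> nat) list) \<Rightarrow> nat \<Rightarrow> rat mat" where
  "weak_order_prod_mat n e l =
     foldr (\<lambda>m A. weak_order_mat n e m * A) [l + 1..<(n choose 2) - l + 1]
       (1\<^sub>m (length (e ((n choose 2) - l))))"

end

theory Submission
  imports Defs "HOL-Library.Function_Algebras"
begin

text \<open>
  The proof avoids any formula for a lowering operator on permutations. Let \<open>u\<^sub>1, \<dots>, u\<^bsub>n-1\<^esub>\<close> be the
  generators of the nilCoxeter algebra; the matrices \<open>M\<^sub>m\<close> describe right multiplication by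
  \<open>\<Sum>k. k u\<^sub>k\<close>. With \<open>A\<^sub>i(x) = (1 + x u\<^sub>i) (1 + x u\<^bsub>i+1\<^esub>) \<dots> (1 + x u\<^bsub>n-1\<^esub>)\<close>, the product
  \<open>A\<^bsub>n-1\<^esub>(x\<^bsub>n-1\<^esub>) \<dots> A\<^sub>1(x\<^sub>1)\<close> is the generating function of the Schubert polynomials, and right
  multiplication by \<open>\<Sum>k. k u\<^sub>k\<close> acts on it as \<open>\<Sum>i. \<partial>/\<partial>x\<^sub>i\<close>. Its coefficients at the monomials
  dividing the staircase monomial form an integral basis of the nilCoxeter algebra, so passing to
  this basis changes determinants only by a sign. There the operator becomes
  \<open>a \<mapsto> \<Sum>q. (a\<^sub>q + 1) (a + e\<^sub>q)\<close> on exponent vectors, the raising operator of a tensor product of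
  irreducible \<open>sl\<^sub>2\<close>-modules. Complementation \<open>a\<^sub>q \<mapsto> q - a\<^sub>q\<close> exchanges it with the lowering
  operator, hence the square of the determinant equals, up to sign, the determinant of raising from
  degree \<open>l\<close> to degree \<open>N - l\<close> and lowering back, which follows from the \<open>sl\<^sub>2\<close> commutation relation and
  Sylvester's identity \<open>t\<^sup>n det (t + A B) = t\<^sup>m det (t + B A)\<close>.
\<close>

section \<open>Determinants of products of raising and lowering matrices\<close>

text \<open>Otherwise the simplifier unfolds sums of functions to abstractions in eta-expanded subterms.\<close>

declare plus_fun_apply [simp del] zero_fun_apply [simp del] minus_apply [simp del]

text \<open>Two block eliminations of one matrix \<open>Z\<close>: the unipotent left factor clears
  the upper right block and keeps \<open>det Z\<close>, the other clears the lower left block at the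
  cost of the factor \<open>t ^ n\<close>. No division by \<open>t\<close> occurs, so
  \<open>t = 0\<close> is covered.\<close>

lemma sylvester_det:
  fixes A B :: "'a::idom mat"
  assumes A: "A \<in> carrier_mat m n" and B: "B \<in> carrier_mat n m"
  shows "t ^ n * det (t \<cdot>\<^sub>m 1\<^sub>m m + A * B) = t ^ m * det (t \<cdot>\<^sub>m 1\<^sub>m n + B * A)"
proof -
  define Z where "Z = four_block_mat (t \<cdot>\<^sub>m 1\<^sub>m m) (- A) B (1\<^sub>m n)"
  have Z: "Z \<in> carrier_mat (m + n) (m + n)"
    unfolding Z_def by (rule four_block_carrier_mat) auto
  have 1: "four_block_mat (1\<^sub>m m) A (0\<^sub>m n m) (1\<^sub>m n) * Z =
      four_block_mat (t \<cdot>\<^sub>m 1\<^sub>m m + A * B) (0\<^sub>m m n) B (1\<^sub>m n)"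
    unfolding Z_def using A B
    by (subst mult_four_block_mat[of _ m m _ n _ n _ _ m _ n]) auto
  have 2: "four_block_mat (1\<^sub>m m) (0\<^sub>m m n) (- B) (t \<cdot>\<^sub>m 1\<^sub>m n) * Z =
      four_block_mat (t \<cdot>\<^sub>m 1\<^sub>m m) (- A) (0\<^sub>m n m) (t \<cdot>\<^sub>m 1\<^sub>m n + B * A)"
  proof -
    have "- B * (t \<cdot>\<^sub>m 1\<^sub>m m) + t \<cdot>\<^sub>m 1\<^sub>m n * B = 0\<^sub>m n m"
      using B by (intro eq_matI) (auto simp: mult_smult_distrib mult_smult_assoc_mat)
    moreover have "- B * (- A) + t \<cdot>\<^sub>m 1\<^sub>m n * 1\<^sub>m n = t \<cdot>\<^sub>m 1\<^sub>m n + B * A"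
      using A B by (intro eq_matI) auto
    ultimately show ?thesis
      unfolding Z_def using A B
      by (subst mult_four_block_mat[of _ m m _ n _ n _ _ m _ n]) auto
  qed
  have "det Z = det (t \<cdot>\<^sub>m 1\<^sub>m m + A * B)"
  proof -
    have "det (four_block_mat (1\<^sub>m m) A (0\<^sub>m n m) (1\<^sub>m n) * Z) = det Z"
      using A Z by (subst det_mult[where n = "m + n"]) (auto simp: det_four_block_mat_lower_left_zero[of _ m _ n])
    then show ?thesis
      using A B unfolding 1 by (subst (asm) det_four_block_mat_upper_right_zero[of _ m _ n]) auto
  qed
  moreover have "t ^ n * det Z = t ^ m * det (t \<cdot>\<^sub>m 1\<^sub>m n + B * A)"
  proof -
    have "det (four_block_mat (1\<^sub>m m) (0\<^sub>m m n) (- B) (t \<cdot>\<^sub>m 1\<^sub>m n) * Z) = t ^ n * det Z"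
      using B Z by (subst det_mult[where n = "m + n"]) (auto simp: det_four_block_mat_upper_right_zero[of _ m _ n])
    then show ?thesis
      using A B unfolding 2 by (subst (asm) det_four_block_mat_lower_left_zero[of _ m _ n]) auto
  qed
  ultimately show ?thesis by simp
qed

section \<open>Products of raising and lowering matrices along a chain of levels\<close>

primrec up_prod :: "(nat \<Rightarrow> 'a::comm_ring_1 mat) \<Rightarrow> (nat \<Rightarrow> nat) \<Rightarrow> nat \<Rightarrow> nat \<Rightarrow> 'a mat" where
  "up_prod K d l 0 = 1\<^sub>m (d l)"
| "up_prod K d l (Suc r) = up_prod K d l r * K (l + Suc r)"

primrec down_prod :: "(nat \<Rightarrow> 'a::comm_ring_1 mat) \<Rightarrow> (nat \<Rightarrow> nat) \<Rightarrow> nat \<Rightarrow> nat \<Rightarrow> 'a mat" where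
  "down_prod L d l 0 = 1\<^sub>m (d l)"
| "down_prod L d l (Suc r) = L (l + Suc r) * down_prod L d l r"

lemma up_prod_carrier:
  assumes "\<And>m. l < m \<Longrightarrow> m \<le> l + r \<Longrightarrow> K m \<in> carrier_mat (d (m - 1)) (d m)"
  shows "up_prod K d l r \<in> carrier_mat (d l) (d (l + r))"
  using assms
proof (induction r)
  case (Suc r)
  have "K (l + Suc r) \<in> carrier_mat (d (l + r)) (d (l + Suc r))"
    using Suc.prems[of "l + Suc r"] by simp
  then show ?case using Suc.IH[OF Suc.prems] by simp
qed simp

lemma down_prod_carrier:
  assumes "\<And>m. l < m \<Longrightarrow> m \<le> l + r \<Longrightarrow> L m \<in> carrier_mat (d m) (d (m - 1))"
  shows "down_prod L d l r \<in> carrier_mat (d (l + r)) (d l)"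
  using assms
proof (induction r)
  case (Suc r)
  have "L (l + Suc r) \<in> carrier_mat (d (l + Suc r)) (d (l + r))"
    using Suc.prems[of "l + Suc r"] by simp
  then show ?case using Suc.IH[OF Suc.prems] by simp
qed simp

lemma foldr_eq_up_prod:
  assumes "\<And>m. l < m \<Longrightarrow> m \<le> l + r \<Longrightarrow> K m \<in> carrier_mat (d (m - 1)) (d m)"
    and "X \<in> carrier_mat (d (l + r)) c"
  shows "foldr (\<lambda>m A. K m * A) [l + 1..<l + r + 1] X = up_prod K d l r * X"
  using assms
proof (induction r arbitrary: X)
  case (Suc r)
  have K: "K (l + Suc r) \<in> carrier_mat (d (l + r)) (d (l + Suc r))"
    using Suc.prems(1)[of "l + Suc r"] by simp
  have P: "up_prod K d l r \<in> carrier_mat (d l) (d (l + r))"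
    by (rule up_prod_carrier) (use Suc.prems(1) in auto)
  have "foldr (\<lambda>m A. K m * A) [l + 1..<l + Suc r + 1] X =
      foldr (\<lambda>m A. K m * A) [l + 1..<l + r + 1] (K (l + Suc r) * X)"
    by simp
  also have "\<dots> = up_prod K d l r * (K (l + Suc r) * X)"
    by (rule Suc.IH) (use Suc.prems K in auto)
  finally show ?case
    using K P Suc.prems(2) by (simp add: assoc_mult_mat[of _ "d l" "d (l + r)" _ "d (l + Suc r)" _ c])
qed simp

lemma up_prod_Suc_left:
  assumes "\<And>m. l < m \<Longrightarrow> m \<le> l + Suc r \<Longrightarrow> K m \<in> carrier_mat (d (m - 1)) (d m)"
  shows "up_prod K d l (Suc r) = K (Suc l) * up_prod (\<lambda>m. K (Suc m)) (\<lambda>m. d (Suc m)) l r"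
  using assms
proof (induction r)
  case 0
  then show ?case using 0[of "Suc l"] by auto
next
  case (Suc r)
  have c: "up_prod (\<lambda>m. K (Suc m)) (\<lambda>m. d (Suc m)) l r \<in> carrier_mat (d (Suc l)) (d (Suc (l + r)))"
    proof (rule up_prod_carrier)
    fix m assume "l < m" "m \<le> l + r"
    then show "K (Suc m) \<in> carrier_mat (d (Suc (m - 1))) (d (Suc m))"
      using Suc.prems[of "Suc m"] by simp
  qed
  have "up_prod K d l (Suc (Suc r)) =
      (K (Suc l) * up_prod (\<lambda>m. K (Suc m)) (\<lambda>m. d (Suc m)) l r) * K (l + Suc (Suc r))"
    using Suc.IH Suc.prems by simp
  also have "\<dots> = K (Suc l) * (up_prod (\<lambda>m. K (Suc m)) (\<lambda>m. d (Suc m)) l r * K (l + Suc (Suc r)))"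
    using Suc.prems[of "Suc l"] Suc.prems[of "l + Suc (Suc r)"] c
    by (intro assoc_mult_mat) auto
  finally show ?case by simp
qed

text \<open>Reflecting the levels \<open>m\<close> to \<open>2 * l + r - m\<close> turns the
  descending product into an ascending one, so that \<open>up_prod_intertwine\<close> also applies
  to lowering matrices.\<close>

lemma down_prod_eq_up_prod:
  assumes "\<And>m. l < m \<Longrightarrow> m \<le> l + r \<Longrightarrow> L m \<in> carrier_mat (d m) (d (m - 1))"
  shows "down_prod L d l r = up_prod (\<lambda>m. L (Suc (2 * l + r) - m)) (\<lambda>m. d (2 * l + r - m)) l r"
  using assms
proof (induction r)
  case (Suc r)
  have *: "up_prod (\<lambda>m. L (Suc (2 * l + Suc r) - m)) (\<lambda>m. d (2 * l + Suc r - m)) l (Suc r) =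
     L (Suc (2 * l + Suc r) - Suc l) *
     up_prod (\<lambda>m. L (Suc (2 * l + Suc r) - Suc m)) (\<lambda>m. d (2 * l + Suc r - Suc m)) l r"
  proof (rule up_prod_Suc_left)
    fix m assume "l < m" "m \<le> l + Suc r"
    then show "L (Suc (2 * l + Suc r) - m) \<in> carrier_mat (d (2 * l + Suc r - (m - 1))) (d (2 * l + Suc r - m))"
      using Suc.prems[of "Suc (2 * l + Suc r) - m"] by (simp add: Suc_diff_le)
  qed
  have "Suc (2 * l + Suc r) - Suc l = l + Suc r" by simp
  with Suc.IH[OF Suc.prems] show ?case unfolding * by simp
qed simp

text \<open>The squares \<open>AB\<close> are pasted together one level at a time. The two
  applications are the change to the monomial basis and complementation.\<close>

lemma up_prod_intertwine:
  assumes A: "\<And>m. l < m \<Longrightarrow> m \<le> l + r \<Longrightarrow> A m \<in> carrier_mat (d (m - 1)) (d m)"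
    and B: "\<And>m. l < m \<Longrightarrow> m \<le> l + r \<Longrightarrow> B m \<in> carrier_mat (d (m - 1)) (d m)"
    and X: "\<And>m. l \<le> m \<Longrightarrow> m \<le> l + r \<Longrightarrow> X m \<in> carrier_mat (d m) (d m)"
    and AB: "\<And>m. l < m \<Longrightarrow> m \<le> l + r \<Longrightarrow> X (m - 1) * A m = B m * X m"
  shows "X l * up_prod A d l r = up_prod B d l r * X (l + r)"
  using assms
proof (induction r)
  case 0
  then show ?case using 0(3)[of l] by simp
next
  case (Suc r)
  let ?m = "l + Suc r"
  have a: "A ?m \<in> carrier_mat (d (l + r)) (d ?m)" and b: "B ?m \<in> carrier_mat (d (l + r)) (d ?m)"
    using Suc.prems(1,2)[of ?m] by auto
  have Pa: "up_prod A d l r \<in> carrier_mat (d l) (d (l + r))"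
    by (rule up_prod_carrier) (use Suc.prems(1) in auto)
  have Pb: "up_prod B d l r \<in> carrier_mat (d l) (d (l + r))"
    by (rule up_prod_carrier) (use Suc.prems(2) in auto)
  have x: "X l \<in> carrier_mat (d l) (d l)" "X (l + r) \<in> carrier_mat (d (l + r)) (d (l + r))"
      "X ?m \<in> carrier_mat (d ?m) (d ?m)"
    using Suc.prems(3) by auto
  have "X l * up_prod A d l (Suc r) = (X l * up_prod A d l r) * A ?m"
    using assoc_mult_mat[OF x(1) Pa a] by simp
  also have "X l * up_prod A d l r = up_prod B d l r * X (l + r)"
    by (rule Suc.IH) (use Suc.prems in auto)
  also have "\<dots> * A ?m = up_prod B d l r * (X (l + r) * A ?m)"
    using assoc_mult_mat[OF Pb x(2) a] .
  also have "X (l + r) * A ?m = B ?m * X ?m"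
    using Suc.prems(4)[of ?m] by simp
  finally show ?case
    using assoc_mult_mat[OF Pb b x(3)] by simp
qed

section \<open>Unimodular matrices and dimension bounds\<close>

lemma det_Ints:
  assumes "A \<in> carrier_mat n n" and "\<And>i j. i < n \<Longrightarrow> j < n \<Longrightarrow> A $$ (i, j) \<in> \<int>"
  shows "det A \<in> (\<int> :: 'a::comm_ring_1 set)"
proof -
  have "signof p \<in> (\<int> :: 'a set)" for p :: "nat \<Rightarrow> nat"
    by (simp add: sign_def)
  then show ?thesis
    unfolding det_def'[OF assms(1)]
    by (intro Ints_sum Ints_mult Ints_prod assms(2)) (auto dest: permutes_in_image)
qed

text \<open>Both determinants are integers and their product is 1.\<close>

lemma det_unimodular:
  fixes A B :: "rat mat"
  assumes "A \<in> carrier_mat n n" "B \<in> carrier_mat n n"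
    and "\<And>i j. i < n \<Longrightarrow> j < n \<Longrightarrow> A $$ (i, j) \<in> \<int>" "\<And>i j. i < n \<Longrightarrow> j < n \<Longrightarrow> B $$ (i, j) \<in> \<int>"
    and "A * B = 1\<^sub>m n"
  shows "det B = 1 \<or> det B = - 1"
proof -
  obtain a b :: int where ab: "det A = of_int a" "det B = of_int b"
    using det_Ints[OF assms(1,3)] det_Ints[OF assms(2,4)] by (metis Ints_cases)
  have "det A * det B = 1"
    using det_mult[OF assms(1,2)] assms(5) by simp
  then have "of_int (a * b) = (of_int 1 :: rat)"
    unfolding ab by simp
  then have "a * b = 1" by (simp only: of_int_eq_iff)
  then have "b = 1 \<or> b = -1"
    by (metis mult.commute zmult_eq_1_iff)
  then show ?thesis using ab by auto
qed

text \<open>If \<open>c < w\<close>, padding with zeros to size \<open>w\<close> keeps the product,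
  but the padded right factor has a zero row \<open>c\<close> and hence determinant 0.\<close>

lemma left_inverse_dim_le:
  fixes A B :: "'a::idom mat"
  assumes A: "A \<in> carrier_mat w c" and B: "B \<in> carrier_mat c w" and AB: "A * B = 1\<^sub>m w"
  shows "w \<le> c"
proof (rule ccontr)
  assume "\<not> w \<le> c"
  then have cw: "c < w" by simp
  define B' where "B' = mat w w (\<lambda>(i, j). if i < c then B $$ (i, j) else 0)"
  define A' where "A' = mat w w (\<lambda>(i, j). if j < c then A $$ (i, j) else 0)"
  have "A' * B' = A * B"
  proof (rule eq_matI)
    fix i j assume "i < dim_row (A * B)" "j < dim_col (A * B)"
    then have ij: "i < w" "j < w" using A B by auto
    have "(A' * B') $$ (i, j) = (\<Sum>k\<in>{0..<w}. if k < c then A $$ (i, k) * B $$ (k, j) else 0)"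
      using ij by (auto simp: A'_def B'_def scalar_prod_def intro!: sum.cong)
    also have "\<dots> = (\<Sum>k\<in>{0..<c}. A $$ (i, k) * B $$ (k, j))"
      using cw by (intro sum.mono_neutral_cong_right) auto
    also have "\<dots> = (A * B) $$ (i, j)"
      using ij A B by (auto simp: scalar_prod_def)
    finally show "(A' * B') $$ (i, j) = (A * B) $$ (i, j)" .
  qed (use A B in \<open>auto simp: A'_def B'_def\<close>)
  then have "det A' * det B' = 1"
    using AB det_mult[of A' w B'] by (simp add: A'_def B'_def)
  moreover have "det B' = 0"
    using cw by (subst det_def'[of _ w]) (auto simp: B'_def intro!: sum.neutral prod_zero bexI[of _ c] dest: permutes_in_image[of _ _ c])
  ultimately show False by simp
qed

section \<open>Raising and lowering back under the sl2 commutation relation\<close>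

lemma smult_one_add_smult_one:
  fixes X :: "'a::comm_ring_1 mat"
  assumes "X \<in> carrier_mat n n"
  shows "(s \<cdot>\<^sub>m 1\<^sub>m n + X) + t \<cdot>\<^sub>m 1\<^sub>m n = (s + t) \<cdot>\<^sub>m 1\<^sub>m n + X"
  using assms by (intro eq_matI) (auto simp: distrib_right)

text \<open>Matrices act on row vectors. At \<open>m = 0\<close> truncated subtraction gives \<open>m - 1 = 0\<close>, so the matrices
  with index 0 map level 0 to itself; \<open>bottom\<close> makes them harmless.\<close>

locale sl2_chain =
  fixes K L :: "nat \<Rightarrow> rat mat" and d :: "nat \<Rightarrow> nat" and N :: nat
  assumes K: "K m \<in> carrier_mat (d (m - 1)) (d m)"
    and L: "L m \<in> carrier_mat (d m) (d (m - 1))"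
    and comm: "K (Suc m) * L (Suc m) = L m * K m + (of_nat N - 2 * of_nat m) \<cdot>\<^sub>m 1\<^sub>m (d m)"
    and bottom: "L 0 * K 0 = 0\<^sub>m (d 0) (d 0)"
begin

text \<open>For a finite-dimensional sl2-module and \<open>2 * k \<le> N\<close>, this counts the
  irreducible summands whose lowest vector has level \<open>k\<close>. The type \<open>int\<close>
  allows for a difference whose sign is not known in advance.\<close>

definition mult :: "nat \<Rightarrow> int" where
  "mult k = int (d k) - (if k = 0 then 0 else int (d (k - 1)))"

text \<open>Sylvester's identity moves \<open>L (Suc l) * K (Suc l)\<close> to level \<open>l\<close>, where the commutation relation
  only changes the shift \<open>s\<close>.\<close>

lemma det_shifted:
  assumes "s > 0" "2 * l \<le> N + 1"
  shows "det (s \<cdot>\<^sub>m 1\<^sub>m (d l) + L l * K l) =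
    (\<Prod>k=0..l. (s + (of_nat l - of_nat k) * (of_nat N + 1 - of_nat l - of_nat k)) powi mult k)"
  using assms
proof (induction l arbitrary: s)
  case 0
  have "s \<cdot>\<^sub>m 1\<^sub>m (d 0) + L 0 * K 0 = s \<cdot>\<^sub>m 1\<^sub>m (d 0)"
    unfolding bottom by (intro eq_matI) auto
  then show ?case by (simp add: mult_def power_int_of_nat)
next
  case (Suc l)
  let ?s = "s + (of_nat N - 2 * of_nat l)"
  have "of_nat (2 * l) \<le> (of_nat N :: rat)"
    using Suc.prems(2) by (subst of_nat_le_iff) simp
  \<comment> \<open>The shift stays positive up to the middle level, so the induction hypothesis
    applies to it.\<close>
  then have s: "?s > 0" using Suc.prems(1) by simp
  have KL: "s \<cdot>\<^sub>m 1\<^sub>m (d l) + K (Suc l) * L (Suc l) = ?s \<cdot>\<^sub>m 1\<^sub>m (d l) + L l * K l"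
    unfolding comm using K[of l] L[of l] by (intro eq_matI) (auto simp: algebra_simps)
  have "s ^ d l * det (s \<cdot>\<^sub>m 1\<^sub>m (d (Suc l)) + L (Suc l) * K (Suc l)) =
     s ^ d (Suc l) * det (?s \<cdot>\<^sub>m 1\<^sub>m (d l) + L l * K l)"
    using sylvester_det[of "L (Suc l)" "d (Suc l)" "d l" "K (Suc l)" s] K[of "Suc l"] L[of "Suc l"]
    by (simp add: KL)
  also have "det (?s \<cdot>\<^sub>m 1\<^sub>m (d l) + L l * K l) =
     (\<Prod>k=0..l. (?s + (of_nat l - of_nat k) * (of_nat N + 1 - of_nat l - of_nat k)) powi mult k)"
    using Suc.IH[OF s] Suc.prems by simp
  also have "\<dots> = (\<Prod>k=0..l. (s + (of_nat (Suc l) - of_nat k) * (of_nat N + 1 - of_nat (Suc l) - of_nat k)) powi mult k)"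
    by (intro prod.cong refl arg_cong2[of _ _ _ _ power_int]) (auto simp: algebra_simps)
  \<comment> \<open>Cancelling \<open>s ^ d l\<close> leaves \<open>s\<close> with exponent
    \<open>mult (Suc l)\<close>, which is the factor at \<open>k = Suc l\<close>.\<close>
  finally have "det (s \<cdot>\<^sub>m 1\<^sub>m (d (Suc l)) + L (Suc l) * K (Suc l)) = s powi mult (Suc l) * \<dots>"
    using Suc.prems(1) by (simp add: mult_def power_int_diff power_int_of_nat field_simps)
  then show ?case
    using Suc.prems(1) by (simp add: mult.commute)
qed

text \<open>Carrying the lowering matrix to the left through \<open>r + 1\<close> raising matrices
  collects the constants \<open>N - 2 * (l + i)\<close> for \<open>i \<le> r\<close>, whose sum is
  \<open>(r + 1) * (N - 2 * l - r)\<close>.\<close>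

lemma up_prod_comm:
  "up_prod K d l r * (K (Suc (l + r)) * L (Suc (l + r))) =
   ((of_nat (Suc r) * (of_nat N - 2 * of_nat l - of_nat r)) \<cdot>\<^sub>m 1\<^sub>m (d l) + L l * K l) * up_prod K d l r"
proof (induction r)
  case 0
  have "K (Suc l) * L (Suc l) \<in> carrier_mat (d l) (d l)" "L l * K l \<in> carrier_mat (d l) (d l)"
    using K[of "Suc l"] L[of "Suc l"] K[of l] L[of l] by auto
  then show ?case
    by (simp add: comm left_mult_one_mat right_mult_one_mat comm_add_mat[of _ "d l" "d l"])
next
  case (Suc r)
  let ?P = "up_prod K d l r" and ?m = "Suc (l + r)"
  let ?X = "L l * K l"
  let ?s = "of_nat (Suc r) * (of_nat N - 2 * of_nat l - of_nat r) :: rat"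
  let ?s' = "of_nat (Suc (Suc r)) * (of_nat N - 2 * of_nat l - of_nat (Suc r)) :: rat"
  let ?t = "of_nat N - 2 * of_nat ?m :: rat"
  have P: "?P \<in> carrier_mat (d l) (d (l + r))" by (rule up_prod_carrier) (rule K)
  have k: "K ?m \<in> carrier_mat (d (l + r)) (d ?m)" using K[of ?m] by simp
  have l: "L ?m \<in> carrier_mat (d ?m) (d (l + r))" using L[of ?m] by simp
  have PK: "?P * K ?m \<in> carrier_mat (d l) (d ?m)" using P k by simp
  have X: "?X \<in> carrier_mat (d l) (d l)" using K[of l] L[of l] by auto
  have lk: "L ?m * K ?m \<in> carrier_mat (d ?m) (d ?m)" using k l by simp
  have kl: "K ?m * L ?m \<in> carrier_mat (d (l + r)) (d (l + r))" using k l by simp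
  have sX: "?s \<cdot>\<^sub>m 1\<^sub>m (d l) + ?X \<in> carrier_mat (d l) (d l)" using X by simp
  have "(?P * K ?m) * (K (Suc ?m) * L (Suc ?m)) = (?P * K ?m) * (L ?m * K ?m) + (?P * K ?m) * (?t \<cdot>\<^sub>m 1\<^sub>m (d ?m))"
    unfolding comm using PK lk by (intro mult_add_distrib_mat) auto
  also have "(?P * K ?m) * (L ?m * K ?m) = (?P * (K ?m * L ?m)) * K ?m"
    using P k l kl lk by (simp add: assoc_mult_mat[of _ "d l" "d (l+r)" _ "d ?m" _ "d ?m"]
      assoc_mult_mat[of _ "d (l+r)" "d ?m" _ "d (l+r)" _ "d ?m"]
      assoc_mult_mat[of _ "d l" "d (l+r)" _ "d (l+r)" _ "d ?m"])
  also have "\<dots> = (?s \<cdot>\<^sub>m 1\<^sub>m (d l) + ?X) * (?P * K ?m)"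
    unfolding Suc.IH using sX P k by (rule assoc_mult_mat)
  also have "(?P * K ?m) * (?t \<cdot>\<^sub>m 1\<^sub>m (d ?m)) = (?t \<cdot>\<^sub>m 1\<^sub>m (d l)) * (?P * K ?m)"
    using mult_smult_distrib[OF PK one_carrier_mat, of ?t] mult_smult_assoc_mat[OF one_carrier_mat PK, of ?t] PK
    by (simp only: left_mult_one_mat right_mult_one_mat)
  also have "(?s \<cdot>\<^sub>m 1\<^sub>m (d l) + ?X) * (?P * K ?m) + \<dots> =
      ((?s \<cdot>\<^sub>m 1\<^sub>m (d l) + ?X) + ?t \<cdot>\<^sub>m 1\<^sub>m (d l)) * (?P * K ?m)"
    using sX PK by (subst add_mult_distrib_mat) auto
  also have "(?s \<cdot>\<^sub>m 1\<^sub>m (d l) + ?X) + ?t \<cdot>\<^sub>m 1\<^sub>m (d l) = ?s' \<cdot>\<^sub>m 1\<^sub>m (d l) + ?X"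
  proof -
    have "(?s \<cdot>\<^sub>m 1\<^sub>m (d l) + ?X) + ?t \<cdot>\<^sub>m 1\<^sub>m (d l) = (?s + ?t) \<cdot>\<^sub>m 1\<^sub>m (d l) + ?X"
      using X by (rule smult_one_add_smult_one)
    moreover have "?s + ?t = ?s'" by (simp add: algebra_simps)
    ultimately show ?thesis by (simp only:)
  qed
  finally show ?case by simp
qed

text \<open>Resolving the innermost pair by \<open>up_prod_comm\<close> splits off one factor, so
  raising and lowering back is a product of linear polynomials in \<open>L l * K l\<close>.\<close>

lemma det_up_down:
  "det (up_prod K d l r * down_prod L d l r) =
   (\<Prod>j<r. det ((of_nat (Suc j) * (of_nat N - 2 * of_nat l - of_nat j)) \<cdot>\<^sub>m 1\<^sub>m (d l) + L l * K l))"
proof (induction r)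
  case (Suc r)
  let ?P = "up_prod K d l r" and ?m = "Suc (l + r)" and ?Q = "down_prod L d l r"
  let ?Y = "(of_nat (Suc r) * (of_nat N - 2 * of_nat l - of_nat r)) \<cdot>\<^sub>m 1\<^sub>m (d l) + L l * K l"
  have P: "?P \<in> carrier_mat (d l) (d (l + r))" by (rule up_prod_carrier) (rule K)
  have Q: "?Q \<in> carrier_mat (d (l + r)) (d l)" by (rule down_prod_carrier) (rule L)
  have k: "K ?m \<in> carrier_mat (d (l + r)) (d ?m)" using K[of ?m] by simp
  have l: "L ?m \<in> carrier_mat (d ?m) (d (l + r))" using L[of ?m] by simp
  have Y: "?Y \<in> carrier_mat (d l) (d l)" using K[of l] L[of l] by auto
  have kl: "K ?m * L ?m \<in> carrier_mat (d (l + r)) (d (l + r))" using k l by simp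
  have "up_prod K d l (Suc r) * down_prod L d l (Suc r) = (?P * (K ?m * L ?m)) * ?Q"
    using P k l kl Q by (simp add: assoc_mult_mat[of _ "d l" "d (l+r)" _ "d ?m" _ "d l"]
      assoc_mult_mat[of _ "d (l+r)" "d ?m" _ "d (l+r)" _ "d l"]
      assoc_mult_mat[of _ "d l" "d (l+r)" _ "d (l+r)" _ "d l"])
  also have "\<dots> = ?Y * (?P * ?Q)"
    unfolding up_prod_comm using Y P Q by (rule assoc_mult_mat)
  finally have "det (up_prod K d l (Suc r) * down_prod L d l (Suc r)) = det ?Y * det (?P * ?Q)"
    using Y P Q by (simp only: det_mult[of _ "d l"] mult_carrier_mat)
  then show ?case unfolding Suc.IH by (simp add: mult.commute)
qed simp

text \<open>Since \<open>N = 2 * l + r\<close>, the shift in \<open>det_up_down\<close> is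
  \<open>(j + 1) * (r - j)\<close>, and adding \<open>(l - k) * (N + 1 - l - k)\<close> gives
  \<open>(l - k + j + 1) * (N - l - k - j)\<close>. Over \<open>j < r\<close> the two factors
  traverse the interval from \<open>l - k + 1\<close> to \<open>N - l - k\<close> in opposite
  directions; hence the square.\<close>

lemma det_up_down_eq_square:
  assumes "l + r = N - l" "l \<le> N"
  shows "det (up_prod K d l r * down_prod L d l r) =
    (\<Prod>k=0..l. (\<Prod>j=l - k + 1..N - l - k. rat_of_nat j) powi mult k)\<^sup>2"
proof -
  have N: "N = 2 * l + r" using assms by simp
  have "det (up_prod K d l r * down_prod L d l r) =
      (\<Prod>j<r. \<Prod>k=0..l. (of_nat (l - k + Suc j) * of_nat (N - l - k - j)) powi mult k)"
    unfolding det_up_down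
  proof (intro prod.cong refl)
    fix j assume "j \<in> {..<r}"
    then have j: "j < r" by simp
    have eq: "of_nat (Suc j) * (of_nat N - 2 * of_nat l - of_nat j) = (of_nat (Suc j * (r - j)) :: rat)"
      using j by (simp only: of_nat_mult of_nat_diff less_imp_le N of_nat_add) (simp add: algebra_simps)
    have pos: "of_nat (Suc j) * (of_nat N - 2 * of_nat l - of_nat j) > (0 :: rat)"
      unfolding eq of_nat_0_less_iff using j by simp
    show "det ((of_nat (Suc j) * (of_nat N - 2 * of_nat l - of_nat j)) \<cdot>\<^sub>m 1\<^sub>m (d l) + L l * K l) =
      (\<Prod>k=0..l. (of_nat (l - k + Suc j) * of_nat (N - l - k - j)) powi mult k)"
      using j N by (subst det_shifted[OF pos])
        (auto intro!: prod.cong arg_cong2[of _ _ _ _ power_int] simp: of_nat_diff algebra_simps)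
  qed
  also have "\<dots> = (\<Prod>k=0..l. \<Prod>j<r. (of_nat (l - k + Suc j) * of_nat (N - l - k - j)) powi mult k)"
    by (rule prod.swap)
  also have "\<dots> = (\<Prod>k=0..l. ((\<Prod>j=l - k + 1..N - l - k. rat_of_nat j) powi mult k)\<^sup>2)"
  proof (intro prod.cong refl)
    fix k assume "k \<in> {0..l}"
    then have k: "k \<le> l" by simp
    have 1: "(\<Prod>j<r. rat_of_nat (l - k + Suc j)) = (\<Prod>j=l - k + 1..N - l - k. rat_of_nat j)"
      by (rule prod.reindex_bij_witness[of _ "\<lambda>j. j - Suc (l - k)" "\<lambda>j. l - k + Suc j"])
        (use k N in auto)
    have 2: "(\<Prod>j<r. rat_of_nat (N - l - k - j)) = (\<Prod>j=l - k + 1..N - l - k. rat_of_nat j)"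
      by (rule prod.reindex_bij_witness[of _ "\<lambda>j. N - l - k - j" "\<lambda>j. N - l - k - j"])
        (use k N in auto)
    have pw: "(\<Prod>j<r. f j powi z) = (\<Prod>j<r. f j) powi z" for f :: "nat \<Rightarrow> rat" and z
      by (induction r) (auto simp: power_int_mult_distrib)
    show "(\<Prod>j<r. (of_nat (l - k + Suc j) * of_nat (N - l - k - j)) powi mult k) =
      ((\<Prod>j=l - k + 1..N - l - k. rat_of_nat j) powi mult k)\<^sup>2"
      unfolding pw prod.distrib 1 2 by (simp add: power_int_mult_distrib power2_eq_square)
  qed
  finally show ?thesis by (simp only: prod_power_distrib)
qed

end

section \<open>Coxeter length and inversions\<close>

lemma simple_transp_simps [simp]:
  "simple_transp k k = Suc k"
  "simple_transp k (Suc k) = k"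
  "j \<noteq> k \<Longrightarrow> j \<noteq> Suc k \<Longrightarrow> simple_transp k j = j"
  by (auto simp: simple_transp_def)

lemma simple_transp_involutory [simp]:
  "simple_transp k \<circ> simple_transp k = id"
  "simple_transp k (simple_transp k j) = j"
  by (auto simp: simple_transp_def fun_eq_iff)

lemma comp_simple_transp_cancel [simp]: "w \<circ> simple_transp k \<circ> simple_transp k = w"
  by (simp add: fun_eq_iff)

lemma simple_transp_permutes: "k \<in> S \<Longrightarrow> Suc k \<in> S \<Longrightarrow> simple_transp k permutes S"
  unfolding simple_transp_def by (rule permutes_swap_id)

lemma comp_simple_transp_permutes:
  "w permutes S \<Longrightarrow> k \<in> S \<Longrightarrow> Suc k \<in> S \<Longrightarrow> w \<circ> simple_transp k permutes S"
  by (intro permutes_compose simple_transp_permutes)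

lemma inj_comp_simple_transp_eq_iff:
  assumes "inj w"
  shows "w \<circ> simple_transp j = w \<circ> simple_transp k \<longleftrightarrow> j = k"
proof
  assume "w \<circ> simple_transp j = w \<circ> simple_transp k"
  then have *: "simple_transp j = simple_transp k"
    using assms by (simp add: fun.inj_map_strong inj_def fun_eq_iff)
  show "j = k"
  proof (rule ccontr)
    assume "j \<noteq> k"
    then show False
      using fun_cong[OF *, of j] fun_cong[OF *, of k] by (cases "j = Suc k") auto
  qed
qed simp

definition inversions :: "nat \<Rightarrow> (nat \<Rightarrow> nat) \<Rightarrow> (nat \<times> nat) set" where
  "inversions n w = {(i, j). 1 \<le> i \<and> i < j \<and> j \<le> n \<and> w j < w i}"

lemma finite_inversions: "finite (inversions n w)"
  by (rule finite_subset[of _ "{..n} \<times> {..n}"]) (auto simp: inversions_def)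

text \<open>\<open>simple_transp k\<close> preserves the order of every pair \<open>i < j\<close>
  except \<open>(k, Suc k)\<close>, so it carries the inversions of \<open>w\<close> to those of the
  product, and only that pair is new.\<close>

lemma card_inversions_ascent:
  assumes k: "1 \<le> k" "k < n" and asc: "w k < w (Suc k)"
  shows "card (inversions n (w \<circ> simple_transp k)) = Suc (card (inversions n w))"
proof -
  let ?s = "simple_transp k"
  let ?h = "map_prod ?s ?s"
  have inv: "?h (?h x) = x" for x by (cases x) simp
  have lt: "?s i < ?s j" if "i < j" "(i, j) \<noteq> (k, Suc k)" for i j
    using that by (cases "i = k"; cases "i = Suc k"; cases "j = k"; cases "j = Suc k") auto
  have rng: "1 \<le> ?s i \<and> ?s i \<le> n \<longleftrightarrow> 1 \<le> i \<and> i \<le> n" for i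
    using k by (cases "i = k"; cases "i = Suc k") auto
  have "inversions n (w \<circ> ?s) = insert (k, Suc k) (?h ` inversions n w)"
  proof (intro equalityI subsetI)
    fix x assume x: "x \<in> inversions n (w \<circ> ?s)"
    obtain i j where [simp]: "x = (i, j)" by force
    show "x \<in> insert (k, Suc k) (?h ` inversions n w)"
    proof (cases "(i, j) = (k, Suc k)")
      case False
      then have "?h x \<in> inversions n w"
        using x lt[of i j] rng[of i] rng[of j] by (auto simp: inversions_def)
      then show ?thesis using inv[of x] by (metis image_eqI insertCI)
    qed simp
  next
    fix x assume x: "x \<in> insert (k, Suc k) (?h ` inversions n w)"
    show "x \<in> inversions n (w \<circ> ?s)"
    proof (cases "x = (k, Suc k)")
      case True
      then show ?thesis using k asc by (simp add: inversions_def)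
    next
      case False
      then obtain i j where ij: "(i, j) \<in> inversions n w" "x = (?s i, ?s j)" using x by auto
      then have "(i, j) \<noteq> (k, Suc k)" using asc by (auto simp: inversions_def)
      then show ?thesis
        using ij lt[of i j] rng[of i] rng[of j] by (auto simp: inversions_def)
    qed
  qed
  moreover have "(k, Suc k) \<notin> ?h ` inversions n w"
  proof
    assume "(k, Suc k) \<in> ?h ` inversions n w"
    then have "?h (k, Suc k) \<in> inversions n w" using inv by (metis imageE)
    then show False by (simp add: inversions_def)
  qed
  moreover have "inj_on ?h (inversions n w)" using inv by (metis inj_onI)
  ultimately show ?thesis by (simp add: finite_inversions card_image)
qed

lemma card_inversions_descent:
  assumes "1 \<le> k" "k < n" "w (Suc k) < w k"
  shows "card (inversions n w) = Suc (card (inversions n (w \<circ> simple_transp k)))"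
  using card_inversions_ascent[of k n "w \<circ> simple_transp k"] assms by simp

lemma no_descent_imp_id:
  assumes w: "w permutes {1..n}" and asc: "\<And>k. 1 \<le> k \<Longrightarrow> k < n \<Longrightarrow> w k < w (Suc k)"
  shows "w = id"
proof (rule permutes_natset_ge[OF w])
  have "1 \<le> j \<Longrightarrow> j \<le> n \<Longrightarrow> j \<le> w j" for j
  proof (induction j)
    case (Suc j)
    show ?case
    proof (cases "j = 0")
      case True
      then show ?thesis using permutes_in_image[OF w, of 1] Suc.prems by simp
    next
      case False
      then show ?thesis using Suc asc[of j] by fastforce
    qed
  qed simp
  then show "\<forall>j\<in>{1..n}. j \<le> w j" by simp
qed

lemma word_prod_append_single [simp]: "word_prod (ks @ [k]) = word_prod ks \<circ> simple_transp k"
  unfolding word_prod_def by (induction ks) (simp_all add: comp_assoc)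

lemma card_inversions_word_prod_le:
  "set ks \<subseteq> {1..<n} \<Longrightarrow> word_prod ks permutes {1..n} \<and> card (inversions n (word_prod ks)) \<le> length ks"
proof (induction ks rule: rev_induct)
  case Nil
  have "inversions n id = {}" by (auto simp: inversions_def)
  then have "word_prod [] permutes {1..n} \<and> card (inversions n (word_prod [])) \<le> length []"
    by (simp add: word_prod_def permutes_id)
  then show ?case by blast
next
  case (snoc k ks)
  let ?w = "word_prod ks"
  have k: "1 \<le> k" "k < n" using snoc.prems by auto
  have w: "?w permutes {1..n}" "card (inversions n ?w) \<le> length ks" using snoc by auto
  have "?w k \<noteq> ?w (Suc k)" using permutes_inj[OF w(1)] by (metis injD n_not_Suc_n)
  then have "card (inversions n (?w \<circ> simple_transp k)) \<le> Suc (length ks)"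
    using card_inversions_ascent[of k n ?w] card_inversions_descent[of k n ?w] k w(2)
    by (cases "?w k < ?w (Suc k)") auto
  moreover have "?w \<circ> simple_transp k permutes {1..n}"
    using comp_simple_transp_permutes[OF w(1)] k by simp
  ultimately have "word_prod (ks @ [k]) permutes {1..n} \<and> card (inversions n (word_prod (ks @ [k]))) \<le> length (ks @ [k])"
    by simp
  then show ?case by blast
qed

lemma reduced_word_exists:
  assumes "w permutes {1..n}"
  shows "\<exists>ks. length ks = card (inversions n w) \<and> set ks \<subseteq> {1..<n} \<and> word_prod ks = w"
  using assms
proof (induction "card (inversions n w)" arbitrary: w rule: less_induct)
  case less
  show ?case
  proof (cases "\<exists>k. 1 \<le> k \<and> k < n \<and> \<not> w k < w (Suc k)")
    case False
    then have "w = id" using no_descent_imp_id[OF less.prems] by blast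
    moreover have "inversions n id = {}" by (auto simp: inversions_def)
    ultimately show ?thesis by (intro exI[of _ "[]"]) (simp add: word_prod_def)
  next
    case True
    then obtain k where k: "1 \<le> k" "k < n" "\<not> w k < w (Suc k)" by blast
    moreover have "w k \<noteq> w (Suc k)" using permutes_inj[OF less.prems] by (metis injD n_not_Suc_n)
    ultimately have d: "card (inversions n w) = Suc (card (inversions n (w \<circ> simple_transp k)))"
      by (intro card_inversions_descent) auto
    obtain ks where "length ks = card (inversions n (w \<circ> simple_transp k))" "set ks \<subseteq> {1..<n}"
        "word_prod ks = w \<circ> simple_transp k"
      using less.hyps[of "w \<circ> simple_transp k"] comp_simple_transp_permutes[OF less.prems] k d by auto
    then show ?thesis using k d by (intro exI[of _ "ks @ [k]"]) simp
  qed
qed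

text \<open>Each letter changes the number of inversions by exactly one, which bounds word lengths
  from below; cancelling descents on the right until none is left produces a word that attains the
  bound.\<close>

lemma coxeter_length_eq_card_inversions:
  assumes "w permutes {1..n}"
  shows "coxeter_length n w = card (inversions n w)"
  unfolding coxeter_length_def
  by (rule Least_equality) (use reduced_word_exists[OF assms] card_inversions_word_prod_le in auto)

lemma perms_of_length_descent_iff:
  assumes "1 \<le> k" "k < n" "w (Suc k) < w k"
  shows "w \<circ> simple_transp k \<in> perms_of_length n m \<longleftrightarrow> w \<in> perms_of_length n (Suc m)"
proof -
  have "w \<circ> simple_transp k permutes {1..n} \<longleftrightarrow> w permutes {1..n}"
    using comp_simple_transp_permutes[of w "{1..n}" k] comp_simple_transp_permutes[of "w \<circ> simple_transp k" "{1..n}" k] assms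
    by auto
  then show ?thesis
    using card_inversions_descent[of k n w] assms
    by (auto simp: perms_of_length_def coxeter_length_eq_card_inversions)
qed

lemma id_in_perms_of_length_iff: "id \<in> perms_of_length n m \<longleftrightarrow> m = 0"
proof -
  have "inversions n id = {}" by (auto simp: inversions_def)
  then show ?thesis
    by (auto simp: perms_of_length_def coxeter_length_eq_card_inversions permutes_id)
qed

lemma finite_perms_of_length: "finite (perms_of_length n m)"
  by (rule finite_subset[OF _ finite_permutations[of "{1..n}"]]) (auto simp: perms_of_length_def)

section \<open>The nilCoxeter algebra and its monomial basis\<close>

type_synonym perm_fun = "(nat \<Rightarrow> nat) \<Rightarrow> rat"

definition scale :: "rat \<Rightarrow> perm_fun \<Rightarrow> perm_fun" where
  "scale c f = (\<lambda>v. c * f v)"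

text \<open>Right multiplication by the nilCoxeter generator \<open>u\<^sub>k\<close>; a function stands for the formal combination
  \<open>\<Sum>v. f(v) v\<close>.\<close>

definition nil_op :: "nat \<Rightarrow> perm_fun \<Rightarrow> perm_fun" where
  "nil_op k f = (\<lambda>v. if v (Suc k) < v k then f (v \<circ> simple_transp k) else 0)"

definition point :: "(nat \<Rightarrow> nat) \<Rightarrow> perm_fun" where
  "point w = (\<lambda>v. if v = w then 1 else 0)"

lemma scale_apply: "scale c f v = c * f v"
  by (simp add: scale_def)

lemmas fun_apply_simps = plus_fun_apply zero_fun_apply minus_apply scale_apply

lemma scale_zero [simp]: "scale c 0 = 0" "scale 0 f = 0"
  by (simp_all add: fun_eq_iff fun_apply_simps)

lemma scale_add: "scale c (f + g) = scale c f + scale c g"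
  by (simp add: fun_eq_iff fun_apply_simps distrib_left)

section \<open>Linearity and the nilCoxeter relations\<close>

lemma nil_op_zero [simp]: "nil_op k 0 = 0"
  and nil_op_add: "nil_op k (f + g) = nil_op k f + nil_op k g"
  and nil_op_diff: "nil_op k (f - g) = nil_op k f - nil_op k g"
  and nil_op_scale: "nil_op k (scale c f) = scale c (nil_op k f)"
  by (auto simp: nil_op_def fun_eq_iff fun_apply_simps)

lemma nil_op_square [simp]: "nil_op k (nil_op k f) = 0"
  by (auto simp: nil_op_def fun_eq_iff fun_apply_simps)

lemma nil_op_commute:
  assumes "Suc j < k \<or> Suc k < j"
  shows "nil_op j (nil_op k f) = nil_op k (nil_op j f)"
proof -
  have "v \<circ> simple_transp j \<circ> simple_transp k = v \<circ> simple_transp k \<circ> simple_transp j" for v :: "nat \<Rightarrow> nat"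
  proof
    fix x
    show "(v \<circ> simple_transp j \<circ> simple_transp k) x = (v \<circ> simple_transp k \<circ> simple_transp j) x"
      using assms by (cases "x = j"; cases "x = Suc j"; cases "x = k"; cases "x = Suc k") auto
  qed
  then show ?thesis using assms by (intro ext) (auto simp: nil_op_def)
qed

lemma nil_op_braid:
  "nil_op k (nil_op (Suc k) (nil_op k f)) = nil_op (Suc k) (nil_op k (nil_op (Suc k) f))"
proof -
  have "v \<circ> simple_transp k \<circ> simple_transp (Suc k) \<circ> simple_transp k =
      v \<circ> simple_transp (Suc k) \<circ> simple_transp k \<circ> simple_transp (Suc k)" for v :: "nat \<Rightarrow> nat"
  proof
    fix x
    show "(v \<circ> simple_transp k \<circ> simple_transp (Suc k) \<circ> simple_transp k) x =
      (v \<circ> simple_transp (Suc k) \<circ> simple_transp k \<circ> simple_transp (Suc k)) x"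
      by (cases "x = k"; cases "x = Suc k"; cases "x = Suc (Suc k)") auto
  qed
  then show ?thesis by (intro ext) (auto simp: nil_op_def)
qed

lemma nil_op_point:
  assumes "w (Suc k) < w k"
  shows "nil_op k (point (w \<circ> simple_transp k)) = point w"
proof
  fix v
  have "v \<circ> simple_transp k = w \<circ> simple_transp k \<longleftrightarrow> v = w"
    by (metis comp_simple_transp_cancel)
  then show "nil_op k (point (w \<circ> simple_transp k)) v = point w v"
    using assms by (auto simp: nil_op_def point_def)
qed

lemma nil_op_point_cases: "nil_op k (point w) = point (w \<circ> simple_transp k) \<or> nil_op k (point w) = 0"
proof (cases "w k < w (Suc k)")
  case True
  then show ?thesis using nil_op_point[of "w \<circ> simple_transp k" k] by simp
next
  case False
  have "v = w \<circ> simple_transp k" if "v \<circ> simple_transp k = w" for v :: "nat \<Rightarrow> nat"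
    using that by auto
  then have "nil_op k (point w) = 0"
    using False by (fastforce simp: nil_op_def point_def fun_eq_iff fun_apply_simps)
  then show ?thesis ..
qed

text \<open>Right multiplication by the coefficient of \<open>x\<^sup>a\<close> in \<open>(1 + x u\<^sub>i) \<dots> (1 + x u\<^bsub>i+p-1\<^esub>)\<close>.\<close>

primrec elem_op :: "nat \<Rightarrow> nat \<Rightarrow> nat \<Rightarrow> perm_fun \<Rightarrow> perm_fun" where
  "elem_op i 0 a f = (case a of 0 \<Rightarrow> f | Suc b \<Rightarrow> 0)"
| "elem_op i (Suc p) a f =
     (case a of 0 \<Rightarrow> f | Suc b \<Rightarrow> elem_op i p (Suc b) f + nil_op (i + p) (elem_op i p b f))"

lemma elem_op_0 [simp]: "elem_op i p 0 f = f"
  by (cases p) auto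

lemma elem_op_zero [simp]: "elem_op i p a 0 = 0"
  by (induction p arbitrary: a) (auto split: nat.split)

lemma elem_op_add: "elem_op i p a (f + g) = elem_op i p a f + elem_op i p a g"
  by (induction p arbitrary: a) (auto split: nat.split simp: nil_op_add)

lemma elem_op_diff: "elem_op i p a (f - g) = elem_op i p a f - elem_op i p a g"
  by (induction p arbitrary: a) (auto split: nat.split simp: nil_op_diff)

lemma elem_op_scale: "elem_op i p a (scale c f) = scale c (elem_op i p a f)"
  by (induction p arbitrary: a)
    (auto split: nat.split simp: nil_op_scale scale_add)

lemma elem_op_eq_0: "p < a \<Longrightarrow> elem_op i p a f = 0"
  by (induction p arbitrary: a) (auto split: nat.split)

lemma nil_op_elem_op_commute:
  assumes "i + p < k \<or> Suc k < i"
  shows "nil_op k (elem_op i p a f) = elem_op i p a (nil_op k f)"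
  using assms
proof (induction p arbitrary: a)
  case (Suc p)
  have "nil_op k (nil_op (i + p) g) = nil_op (i + p) (nil_op k g)" for g
    using Suc.prems by (intro nil_op_commute) auto
  then show ?case using Suc by (auto split: nat.split simp: nil_op_add)
qed (auto split: nat.split)

text \<open>The weights are counted from \<open>i\<close>, so that passing to the parabolic subgroup
  starting one step later gives \<open>weighted_op (Suc i)\<close>. With \<open>i = 1\<close> and
  \<open>p = n - 1\<close> this is right multiplication by \<open>\<Sum>k. k u\<^sub>k\<close>, the
  operator of the weak order matrices.\<close>

primrec weighted_op :: "nat \<Rightarrow> nat \<Rightarrow> perm_fun \<Rightarrow> perm_fun" where
  "weighted_op i 0 f = 0"
| "weighted_op i (Suc p) f = weighted_op i p f + scale (of_nat (Suc p)) (nil_op (i + p) f)"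

lemma weighted_op_add: "weighted_op i p (f + g) = weighted_op i p f + weighted_op i p g"
  by (induction p) (simp_all add: nil_op_add scale_add algebra_simps)

lemma nil_op_weighted_op_commute:
  assumes "i + p < k"
  shows "nil_op k (weighted_op i p f) = weighted_op i p (nil_op k f)"
  using assms
proof (induction p)
  case (Suc p)
  have "nil_op k (nil_op (i + p) g) = nil_op (i + p) (nil_op k g)" for g
    using Suc.prems by (intro nil_op_commute) auto
  then show ?case using Suc by (auto simp: nil_op_add nil_op_scale)
qed auto

text \<open>Only \<open>nil_op (i + p)\<close>, which has weight \<open>Suc p\<close>, fails to
  commute with its neighbour \<open>nil_op (i + Suc p)\<close>.\<close>

lemma weighted_op_nil_op:
  "weighted_op i (Suc p) (nil_op (i + Suc p) g) =
   nil_op (i + Suc p) (weighted_op i (Suc p) g)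
   + scale (of_nat (Suc p)) (nil_op (i + p) (nil_op (i + Suc p) g) - nil_op (i + Suc p) (nil_op (i + p) g))"
  by (simp add: nil_op_weighted_op_commute nil_op_add nil_op_scale fun_eq_iff fun_apply_simps algebra_simps
      del: of_nat_Suc)

text \<open>Splitting off the top factor \<open>nil_op (i + p)\<close> from each
  \<open>elem_op i (Suc p)\<close> leaves operators that commute with
  \<open>nil_op (i + Suc p)\<close>. Terms with a repeated adjacent generator vanish, and the
  remaining difference is a braid relation.\<close>

lemma elem_op_nil_op_exchange:
  "nil_op (i + Suc p) (elem_op i (Suc p) (Suc b) f)
   + (nil_op (i + p) (nil_op (i + Suc p) (elem_op i (Suc p) b f))
      - nil_op (i + Suc p) (nil_op (i + p) (elem_op i (Suc p) b f))) =
   elem_op i (Suc p) (Suc b) (nil_op (i + Suc p) f)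
   + nil_op (i + Suc p) (elem_op i (Suc p) b (nil_op (i + Suc p) f))"
proof -
  have c: "elem_op i p a (nil_op (Suc (i + p)) f) = nil_op (Suc (i + p)) (elem_op i p a f)" for a
    by (rule nil_op_elem_op_commute[symmetric]) simp
  show ?thesis
    by (cases b) (simp_all add: c nil_op_add nil_op_braid)
qed

text \<open>With \<open>A(x) = (1 + x u\<^sub>i) \<dots> (1 + x u\<^bsub>i+p\<^esub>)\<close> and \<open>e\<^sub>j = \<Sum>k\<ge>j. (k - j + 1) u\<^sub>k\<close>, this is
  \<open>A(x) e\<^sub>i = e\<^bsub>i+1\<^esub> A(x) + A'(x)\<close>; the operators appear in reversed order because they act from the right.\<close>

lemma weighted_op_elem_op:
  "weighted_op i (Suc p) (elem_op i (Suc p) a f) =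
   elem_op i (Suc p) a (weighted_op (Suc i) p f) + scale (of_nat (Suc a)) (elem_op i (Suc p) (Suc a) f)"
proof (induction p arbitrary: a f)
  case 0
  show ?case by (cases a) (auto split: nat.split)
next
  case (Suc p)
  let ?m = "i + Suc p" and ?P = "of_nat (Suc p) :: rat"
  let ?R = "nil_op ?m" and ?H = "elem_op i (Suc p)" and ?W = "weighted_op i (Suc p)"
  let ?E = "weighted_op (Suc i) p"
  have W: "weighted_op i (Suc (Suc p)) g = ?W g + scale (?P + 1) (?R g)" for g
    by (simp add: add.commute)
  have E: "weighted_op (Suc i) (Suc p) g = ?E g + scale ?P (?R g)" for g by simp
  show ?case
  proof (cases a)
    case 0
    then show ?thesis using Suc.IH[of 0 f]
      by (simp add: fun_eq_iff fun_apply_simps algebra_simps)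
  next
    case (Suc b)
    let ?B = "of_nat b :: rat"
    let ?D = "nil_op (i + p) (?R (?H b f)) - ?R (nil_op (i + p) (?H b f))"
    have H: "elem_op i (Suc (Suc p)) (Suc c) g = ?H (Suc c) g + ?R (?H c g)" for c g
      by simp
    have 1: "?W (?H (Suc b) f) = ?H (Suc b) (?E f) + scale (?B + 2) (?H (Suc (Suc b)) f)"
      using Suc.IH[of "Suc b" f] by (simp del: elem_op.simps weighted_op.simps add: add.commute)
    have "?W (?H b f) = ?H b (?E f) + scale (?B + 1) (?H (Suc b) f)"
      using Suc.IH[of b f] by (simp del: elem_op.simps weighted_op.simps add: add.commute)
    then have 2: "?W (?R (?H b f)) = ?R (?H b (?E f)) + scale (?B + 1) (?R (?H (Suc b) f)) + scale ?P ?D"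
      unfolding weighted_op_nil_op by (simp only: nil_op_add nil_op_scale)
    have 3: "?R (?H (Suc b) f) + ?D = ?H (Suc b) (?R f) + ?R (?H b (?R f))"
      by (rule elem_op_nil_op_exchange)
    have a: "of_nat (Suc (Suc b)) = ?B + 2" by simp
    show ?thesis
      unfolding Suc H W E weighted_op_add 1 2 nil_op_add elem_op_add elem_op_scale nil_op_scale nil_op_square a
    proof (rule ext, goal_cases)
      case (1 v)
      \<comment> \<open>Both sides are now linear in finitely many values at \<open>v\<close>; the
        hypothesis is relation \<open>3\<close>, and the term with factor 0 comes from the square of
        \<open>nil_op ?m\<close>.\<close>
      have *: "h + (B + 2) * h' + (P + 1) * y + (k + (B + 1) * y + P * z + (P + 1) * 0) =
          h + k + P * (x + x') + (B + 2) * (h' + y)" if "y + z = x + x'" for h h' k x x' y z B P :: rat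
        unfolding that[symmetric] by (simp add: algebra_simps)
      show ?case using fun_cong[OF 3, of v] unfolding fun_apply_simps by (rule *)
    qed
  qed
qed

text \<open>The coefficient of \<open>\<Prod>r<q. x\<^sub>r\<^bsup>a(r)\<^esup>\<close> in the Schubert generating function of the parabolic subgroup
  on \<open>{n - q + 1..n}\<close>; here the variable with index \<open>r\<close> has maximal exponent \<open>r\<close>.\<close>

primrec monom_image :: "nat \<Rightarrow> nat \<Rightarrow> (nat \<Rightarrow> nat) \<Rightarrow> perm_fun" where
  "monom_image n 0 a = point id"
| "monom_image n (Suc q) a = elem_op (n - q) q (a q) (monom_image n q a)"

lemma monom_image_cong: "(\<And>r. r < q \<Longrightarrow> a r = b r) \<Longrightarrow> monom_image n q a = monom_image n q b"
  by (induction q) auto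

lemma monom_image_upd [simp]: "q \<le> r \<Longrightarrow> monom_image n q (a(r := x)) = monom_image n q a"
  by (rule monom_image_cong) auto

lemma elem_op_sum: "elem_op i p a (\<Sum>x\<in>A. g x) = (\<Sum>x\<in>A. elem_op i p a (g x))"
  by (induction A rule: infinite_finite_induct) (auto simp: elem_op_add)

text \<open>This is the action as \<open>\<Sum>i. \<partial>/\<partial>x\<^sub>i\<close>, read off
  on coefficients: each factor contributes the derivative in its own variable and passes the
  operator on to the next smaller parabolic subgroup.\<close>

lemma weighted_op_monom_image:
  assumes "q < n"
  shows "weighted_op (n - q) q (monom_image n (Suc q) a) =
    (\<Sum>r\<le>q. scale (of_nat (Suc (a r))) (monom_image n (Suc q) (a(r := Suc (a r)))))"
  using assms
proof (induction q)
  case 0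
  then show ?case by (auto split: nat.split)
next
  case (Suc q)
  let ?i = "n - Suc q" and ?B = "monom_image n (Suc q)"
  let ?H = "elem_op ?i (Suc q)"
  have i: "Suc ?i = n - q" using Suc.prems by simp
  have "weighted_op ?i (Suc q) (monom_image n (Suc (Suc q)) a) =
      ?H (a (Suc q)) (weighted_op (n - q) q (?B a)) + scale (of_nat (Suc (a (Suc q)))) (?H (Suc (a (Suc q))) (?B a))"
    unfolding monom_image.simps(2)[of n "Suc q"] weighted_op_elem_op i ..
  also have "weighted_op (n - q) q (?B a) =
      (\<Sum>r\<le>q. scale (of_nat (Suc (a r))) (?B (a(r := Suc (a r)))))"
    by (rule Suc.IH) (use Suc.prems in simp)
  also have "?H (a (Suc q)) \<dots> =
      (\<Sum>r\<le>q. scale (of_nat (Suc (a r))) (monom_image n (Suc (Suc q)) (a(r := Suc (a r)))))"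
    unfolding elem_op_sum elem_op_scale by (intro sum.cong) auto
  also have "?H (Suc (a (Suc q))) (?B a) = monom_image n (Suc (Suc q)) (a(Suc q := Suc (a (Suc q))))"
    unfolding monom_image.simps(2)[of n "Suc q"] by (simp del: elem_op.simps monom_image.simps)
  finally show ?case
    by (simp only: sum.atMost_Suc)
qed

section \<open>Integral span of the monomial images\<close>

inductive_set int_span :: "'a::ab_group_add set \<Rightarrow> 'a set" for S where
  zero: "0 \<in> int_span S"
| base: "x \<in> S \<Longrightarrow> x \<in> int_span S"
| diff: "x \<in> int_span S \<Longrightarrow> y \<in> int_span S \<Longrightarrow> x - y \<in> int_span S"

lemma int_span_uminus: "x \<in> int_span S \<Longrightarrow> - x \<in> int_span S"
  using int_span.diff[OF int_span.zero] by fastforce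

lemma int_span_add: "x \<in> int_span S \<Longrightarrow> y \<in> int_span S \<Longrightarrow> x + y \<in> int_span S"
  using int_span.diff[OF _ int_span_uminus] by fastforce

lemma int_span_image:
  assumes "x \<in> int_span S" and "\<And>x y. h (x - y) = h x - h y"
    and "\<And>s. s \<in> S \<Longrightarrow> h s \<in> int_span T"
  shows "h x \<in> int_span T"
  using assms(1)
proof induction
  case zero
  have "h 0 = 0" using assms(2)[of 0 0] by simp
  then show ?case by (simp add: int_span.zero)
qed (auto simp: assms intro: int_span.diff)

lemma int_span_subset:
  assumes "x \<in> int_span S" and "S \<subseteq> int_span T"
  shows "x \<in> int_span T"
  using int_span_image[of x S "\<lambda>x. x" T] assms by auto

lemma int_span_coefficients:
  assumes "f \<in> int_span (g ` I)" and "finite I"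
  shows "\<exists>c :: 'i \<Rightarrow> int. \<forall>v. (f v :: rat) = (\<Sum>i\<in>I. of_int (c i) * g i v)"
  using assms(1)
proof induction
  case zero
  show ?case by (intro exI[of _ "\<lambda>_. 0"]) (simp add: fun_apply_simps)
next
  case (base f)
  then obtain i where "i \<in> I" "f = g i" by auto
  moreover have "(\<Sum>j\<in>I. of_int (if j = i then 1 else 0) * g j v) = (\<Sum>j\<in>I. if j = i then g j v else 0)" for v
    by (intro sum.cong) auto
  ultimately show ?case using assms(2)
    by (intro exI[of _ "\<lambda>j. if j = i then 1 else 0"]) simp
next
  case (diff x y)
  then obtain c c' :: "'i \<Rightarrow> int" where "\<forall>v. x v = (\<Sum>i\<in>I. of_int (c i) * g i v)" "\<forall>v. y v = (\<Sum>i\<in>I. of_int (c' i) * g i v)"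
    by blast
  then show ?case
    by (intro exI[of _ "\<lambda>i. c i - c' i"]) (simp add: left_diff_distrib sum_subtractf fun_apply_simps)
qed

text \<open>Right multiplication by the minimal coset representative \<open>u\<^sub>i u\<^bsub>i+1\<^esub> \<dots> u\<^bsub>i+b-1\<^esub>\<close>.\<close>

primrec coset_op :: "nat \<Rightarrow> nat \<Rightarrow> perm_fun \<Rightarrow> perm_fun" where
  "coset_op i 0 f = f"
| "coset_op i (Suc b) f = nil_op (i + b) (coset_op i b f)"

lemma coset_op_commute: "i + b < k \<Longrightarrow> nil_op k (coset_op i b f) = coset_op i b (nil_op k f)"
proof (induction b)
  case (Suc b)
  have "nil_op k (nil_op (i + b) g) = nil_op (i + b) (nil_op k g)" for g
    using Suc.prems by (intro nil_op_commute) auto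
  then show ?case using Suc by simp
qed simp

text \<open>In each subword of \<open>u\<^sub>i u\<^bsub>i+1\<^esub> \<dots>\<close>, the factors after the first gap commute with the initial run,
  which is a shorter coset representative unless there is no gap.\<close>

lemma elem_op_triangular:
  assumes L: "\<And>k g. i < k \<Longrightarrow> k < i + p \<Longrightarrow> g \<in> L \<Longrightarrow> nil_op k g \<in> L"
    and "f \<in> L" "b \<le> p"
  shows "elem_op i p b f - coset_op i b f \<in> int_span {coset_op i c g | c g. c < b \<and> g \<in> L}"
  using assms
proof (induction p arbitrary: b)
  case 0
  then show ?case by (simp add: int_span.zero)
next
  case (Suc p)
  let ?X = "\<lambda>b. int_span {coset_op i c g | c g. c < b \<and> g \<in> L}"
  have IH: "elem_op i p b f - coset_op i b f \<in> ?X b" if "b \<le> p" for b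
    by (rule Suc.IH) (use Suc.prems that in auto)
  have mono: "x \<in> ?X b'" if "x \<in> ?X b" "b \<le> b'" for x b b'
    using that(1) by (rule int_span_subset) (use that(2) in \<open>force intro: int_span.base\<close>)
  have shift: "nil_op (i + p) x \<in> ?X b" if "x \<in> ?X b" "b \<le> p" for x b
  proof (rule int_span_image[where h = "nil_op (i + p)", OF that(1) nil_op_diff])
    fix s assume "s \<in> {coset_op i c g | c g. c < b \<and> g \<in> L}"
    then obtain c g where s: "s = coset_op i c g" "c < b" "g \<in> L" by auto
    then have "nil_op (i + p) s = coset_op i c (nil_op (i + p) g)"
      using that(2) by (simp add: coset_op_commute)
    moreover have "nil_op (i + p) g \<in> L"
      by (rule Suc.prems(1)) (use s that(2) in auto)
    ultimately show "nil_op (i + p) s \<in> ?X b"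
      using s(2) by (intro int_span.base) auto
  qed
  show ?case
  proof (cases b)
    case 0
    then show ?thesis by (simp add: int_span.zero)
  next
    case (Suc b')
    note b = this
    have b': "b' \<le> p" using Suc Suc.prems by simp
    have 1: "nil_op (i + p) (elem_op i p b' f) - nil_op (i + p) (coset_op i b' f) \<in> ?X b'"
      using shift[OF IH[OF b'] b'] by (simp add: nil_op_diff)
    show ?thesis
    proof (cases "b' = p")
      case True
      then show ?thesis
        using mono[OF 1, of b] by (simp add: b elem_op_eq_0)
    next
      case False
      then have lt: "b' < p" using b' by simp
      have "nil_op (i + p) (coset_op i b' f) = coset_op i b' (nil_op (i + p) f)"
        using lt by (simp add: coset_op_commute)
      moreover have "nil_op (i + p) f \<in> L"
        by (rule Suc.prems(1)) (use lt Suc.prems in auto)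
      ultimately have "nil_op (i + p) (coset_op i b' f) \<in> ?X b"
        using b by (intro int_span.base) auto
      from int_span_add[OF this mono[OF 1, of b]]
      have "nil_op (i + p) (elem_op i p b' f) \<in> ?X b" using b by simp
      from int_span_add[OF IH[of b] this] show ?thesis
        using lt b by (simp add: algebra_simps)
    qed
  qed
qed

text \<open>Strong induction on \<open>b\<close> inverts the unitriangular expansion of
  \<open>elem_op_triangular\<close> over the integers.\<close>

lemma coset_op_in_span:
  assumes L: "\<And>k g. i < k \<Longrightarrow> k < i + p \<Longrightarrow> g \<in> L \<Longrightarrow> nil_op k g \<in> L"
    and "f \<in> L" "b \<le> p"
  shows "coset_op i b f \<in> int_span {elem_op i p c g | c g. c \<le> p \<and> g \<in> L}"
  using assms(2,3)
proof (induction b arbitrary: f rule: less_induct)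
  case (less b)
  let ?Y = "int_span {elem_op i p c g | c g. c \<le> p \<and> g \<in> L}"
  have 1: "elem_op i p b f - coset_op i b f \<in> ?Y"
    using elem_op_triangular[OF L less.prems]
    by (rule int_span_subset) (use less in auto)
  have 2: "elem_op i p b f \<in> ?Y"
    using less.prems by (intro int_span.base) auto
  have "coset_op i b f \<in> ?Y"
    using int_span.diff[OF 2 1] by (simp add: algebra_simps)
  then show ?case by blast
qed

text \<open>The smallest letter \<open>i\<close> sits at position \<open>i + b\<close>. Each
  exchange with its left neighbour removes a descent, and after \<open>b\<close> exchanges
  \<open>i\<close> is fixed.\<close>

lemma point_coset_decomposition:
  assumes "w permutes {i..n}" "w (i + b) = i" "i + b \<le> n"
  shows "\<exists>u. u permutes {Suc i..n} \<and> point w = coset_op i b (point u)"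
  using assms
proof (induction b arbitrary: w)
  case 0
  have "w permutes {Suc i..n}"
  proof (rule permutes_superset[OF 0(1)])
    fix x assume "x \<in> {i..n} - {Suc i..n}"
    then have "x = i" by auto
    then show "w x = x" using 0 by simp
  qed
  then show ?case by auto
next
  case (Suc b)
  let ?k = "i + b"
  have "w \<circ> simple_transp ?k permutes {i..n}"
    using Suc.prems by (intro comp_simple_transp_permutes) auto
  moreover have "(w \<circ> simple_transp ?k) ?k = i" "?k \<le> n"
    using Suc.prems by auto
  ultimately obtain u where u: "u permutes {Suc i..n}" "point (w \<circ> simple_transp ?k) = coset_op i b (point u)"
    using Suc.IH by blast
  have "w ?k \<in> {i..n}" using permutes_in_image[OF Suc.prems(1), of ?k] Suc.prems(3) by simp
  moreover have "w ?k \<noteq> w (Suc ?k)" using permutes_inj[OF Suc.prems(1)] by (metis injD n_not_Suc_n)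
  ultimately have "w (Suc ?k) < w ?k" using Suc.prems(2) by simp
  from nil_op_point[OF this] u show ?case by auto
qed

text \<open>Exponent vectors of the divisors of the staircase monomial. \<open>PiE\<close> fixes the
  values outside \<open>{..<n}\<close>, so a vector is determined by its exponents.\<close>

definition staircase :: "nat \<Rightarrow> (nat \<Rightarrow> nat) set" where
  "staircase n = PiE {..<n} (\<lambda>q. {..q})"

text \<open>Induction along the chain of parabolic subgroups: the position of the smallest letter
  \<open>i\<close> determines a coset representative, which \<open>coset_op_in_span\<close> trades
  for operators \<open>elem_op i q c\<close> with \<open>c \<le> q\<close>, that is, for one more
  exponent.\<close>

lemma point_in_span_monom_image:
  assumes "q \<le> n" "w permutes {Suc (n - q)..n}"
  shows "point w \<in> int_span (monom_image n q ` staircase q)"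
  using assms
proof (induction q arbitrary: w)
  case 0
  then have "w = id" by (simp add: permutes_empty)
  then have "point w \<in> int_span (monom_image n 0 ` staircase 0)"
    by (auto simp: staircase_def intro: int_span.base)
  then show ?case by blast
next
  case (Suc q)
  define i where "i = n - q"
  have i: "Suc (n - Suc q) = i" "i + q = n" "i \<le> n" using Suc.prems(1) by (auto simp: i_def)
  let ?L = "int_span (point ` {u. u permutes {Suc i..n}})"
  have w: "w permutes {i..n}" using Suc.prems(2) by (simp add: i)
  obtain x where x: "w x = i" using permutes_surj[OF w] by (metis surjD)
  have "x \<in> {i..n}" using permutes_in_image[OF w, of x] x i by simp
  then obtain b where b: "x = i + b" "b \<le> q" using i by (metis atLeastAtMost_iff le_add_diff_inverse add_le_cancel_left)
  then obtain u where u: "u permutes {Suc i..n}" "point w = coset_op i b (point u)"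
    using point_coset_decomposition[OF w, of b] x i by auto
  \<comment> \<open>Since \<open>i < k\<close> and \<open>k < i + q = n\<close>, both
    \<open>k\<close> and \<open>Suc k\<close> lie in \<open>{Suc i..n}\<close>; multiplication stays
    in the smaller group or gives 0.\<close>
  have closed: "nil_op k g \<in> ?L" if "i < k" "k < i + q" "g \<in> ?L" for k g
  proof (rule int_span_image[where h = "nil_op k", OF that(3) nil_op_diff])
    fix s assume "s \<in> point ` {u. u permutes {Suc i..n}}"
    then obtain u where "u permutes {Suc i..n}" "s = point u" by auto
    then show "nil_op k s \<in> ?L"
      using nil_op_point_cases[of k u] comp_simple_transp_permutes[of u "{Suc i..n}" k] that i
      by (auto intro: int_span.base int_span.zero)
  qed
  have "point w \<in> int_span {elem_op i q c g | c g. c \<le> q \<and> g \<in> ?L}"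
    unfolding u(2) using closed _ b(2)
    by (rule coset_op_in_span) (use u(1) in \<open>auto intro: int_span.base\<close>)
  then show ?case
  proof (rule int_span_subset, safe)
    fix c g assume c: "c \<le> q" and g: "g \<in> ?L"
    from g have "g \<in> int_span (monom_image n q ` staircase q)"
      by (rule int_span_subset) (use Suc.IH Suc.prems(1) in \<open>auto simp: i_def\<close>)
    show "elem_op i q c g \<in> int_span (monom_image n (Suc q) ` staircase (Suc q))"
    proof (rule int_span_image[where h = "elem_op i q c", OF \<open>g \<in> int_span (monom_image n q ` staircase q)\<close> elem_op_diff])
      fix s assume "s \<in> monom_image n q ` staircase q"
      then obtain a where a: "a \<in> staircase q" "s = monom_image n q a" by auto
      have "a(q := c) \<in> staircase (Suc q)"
        using a(1) c by (auto simp: staircase_def PiE_iff extensional_def less_Suc_eq)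
      moreover have "monom_image n (Suc q) (a(q := c)) = elem_op i q c s"
        by (simp add: a i_def)
      ultimately show "elem_op i q c s \<in> int_span (monom_image n (Suc q) ` staircase (Suc q))"
        by (metis imageI int_span.base)
    qed
  qed
qed

section \<open>Integrality and degree of the monomial images\<close>

lemma elem_op_Ints: "(\<And>v. f v \<in> \<int>) \<Longrightarrow> elem_op i p a f v \<in> \<int>"
proof (induction p arbitrary: a v)
  case (Suc p)
  then show ?case by (auto split: nat.split simp: nil_op_def plus_fun_apply)
qed (auto split: nat.split simp: zero_fun_apply)

lemma monom_image_Ints: "monom_image n q a v \<in> \<int>"
  by (induction q arbitrary: v) (auto simp: point_def intro!: elem_op_Ints)

lemma elem_op_support:
  assumes "i + p \<le> n" "1 \<le> i"
    and f: "\<And>v. f v \<noteq> 0 \<Longrightarrow> v \<in> perms_of_length n m"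
    and "elem_op i p a f v \<noteq> 0"
  shows "v \<in> perms_of_length n (m + a)"
  using assms(1,4)
proof (induction p arbitrary: a v)
  case 0
  then show ?case using f by (cases a) (auto simp: zero_fun_apply)
next
  case (Suc p)
  show ?case
  proof (cases a)
    case 0
    then show ?thesis using Suc.prems f by simp
  next
    case (Suc b)
    then consider "elem_op i p (Suc b) f v \<noteq> 0" | "nil_op (i + p) (elem_op i p b f) v \<noteq> 0"
      using Suc.prems by (fastforce simp: plus_fun_apply)
    then show ?thesis
    proof cases
      case 1
      then show ?thesis using Suc.IH[of "Suc b" v] Suc.prems Suc by simp
    next
      case 2
      then have d: "v (Suc (i + p)) < v (i + p)" and "elem_op i p b f (v \<circ> simple_transp (i + p)) \<noteq> 0"
        by (auto simp: nil_op_def split: if_splits)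
      then have "v \<circ> simple_transp (i + p) \<in> perms_of_length n (m + b)"
        using Suc.IH Suc.prems by simp
      then show ?thesis
        using perms_of_length_descent_iff[of "i + p" n v "m + b"] d Suc Suc.prems assms(2) by simp
    qed
  qed
qed

text \<open>Every generator that acts nontrivially adds one to the length, so the degree of the
  monomial becomes the length. This splits the change of basis into one block for each
  level.\<close>

lemma monom_image_support:
  assumes "q \<le> n" "monom_image n q a v \<noteq> 0"
  shows "v \<in> perms_of_length n (\<Sum>r<q. a r)"
  using assms
proof (induction q arbitrary: v)
  case 0
  then show ?case by (auto simp: point_def id_in_perms_of_length_iff split: if_splits)
next
  case (Suc q)
  have "v \<in> perms_of_length n ((\<Sum>r<q. a r) + a q)"
    by (rule elem_op_support[of "n - q" q n "monom_image n q a"]) (use Suc in auto)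
  then show ?case by simp
qed

section \<open>The staircase module\<close>

definition fun_mat :: "'a list \<Rightarrow> 'b list \<Rightarrow> ('a \<Rightarrow> 'b \<Rightarrow> rat) \<Rightarrow> rat mat" where
  "fun_mat xs ys F = mat (length xs) (length ys) (\<lambda>(i, j). F (xs ! i) (ys ! j))"

lemma fun_mat_carrier [simp]: "fun_mat xs ys F \<in> carrier_mat (length xs) (length ys)"
  by (simp add: fun_mat_def)

lemma fun_mat_cong:
  "(\<And>x y. x \<in> set xs \<Longrightarrow> y \<in> set ys \<Longrightarrow> F x y = G x y) \<Longrightarrow> fun_mat xs ys F = fun_mat xs ys G"
  unfolding fun_mat_def by (intro cong_mat) auto

lemma fun_mat_mult:
  assumes "distinct ys"
  shows "fun_mat xs ys F * fun_mat ys zs G = fun_mat xs zs (\<lambda>x z. \<Sum>y\<in>set ys. F x y * G y z)"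
proof (rule eq_matI)
  fix i j
  assume "i < dim_row (fun_mat xs zs (\<lambda>x z. \<Sum>y\<in>set ys. F x y * G y z))"
    and "j < dim_col (fun_mat xs zs (\<lambda>x z. \<Sum>y\<in>set ys. F x y * G y z))"
  then have ij: "i < length xs" "j < length zs" by (auto simp: fun_mat_def)
  have "(fun_mat xs ys F * fun_mat ys zs G) $$ (i, j) =
      (\<Sum>k\<in>{..<length ys}. F (xs ! i) (ys ! k) * G (ys ! k) (zs ! j))"
    using ij by (simp add: fun_mat_def scalar_prod_def atLeast0LessThan)
  also have "\<dots> = (\<Sum>y\<in>set ys. F (xs ! i) y * G y (zs ! j))"
    by (rule sum.reindex_bij_betw[OF bij_betw_nth[OF assms refl refl]])
  finally show "(fun_mat xs ys F * fun_mat ys zs G) $$ (i, j) =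
      fun_mat xs zs (\<lambda>x z. \<Sum>y\<in>set ys. F x y * G y z) $$ (i, j)"
    using ij by (simp add: fun_mat_def)
qed (auto simp: fun_mat_def)

lemma fun_mat_one: "distinct xs \<Longrightarrow> fun_mat xs xs (\<lambda>x y. if x = y then 1 else 0) = 1\<^sub>m (length xs)"
  by (rule eq_matI) (auto simp: fun_mat_def nth_eq_iff_index_eq)

lemma fun_mat_add_scalar:
  "distinct xs \<Longrightarrow> fun_mat xs xs (\<lambda>x y. F x y + (if x = y then t else 0)) =
    fun_mat xs xs F + t \<cdot>\<^sub>m 1\<^sub>m (length xs)"
  by (rule eq_matI) (auto simp: fun_mat_def nth_eq_iff_index_eq)

lemma det_fun_mat_unimodular:
  assumes "distinct xs" "distinct ys" "length xs = length ys"
    and "\<And>x y. F x y \<in> \<int>" "\<And>x y. G x y \<in> \<int>"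
    and "\<And>y y'. y \<in> set ys \<Longrightarrow> y' \<in> set ys \<Longrightarrow> (\<Sum>x\<in>set xs. G y x * F x y') = (if y = y' then 1 else 0)"
  shows "det (fun_mat xs ys F) = 1 \<or> det (fun_mat xs ys F) = - 1"
proof (rule det_unimodular)
  show "fun_mat ys xs G * fun_mat xs ys F = 1\<^sub>m (length ys)"
    unfolding fun_mat_mult[OF assms(1)] fun_mat_one[OF assms(2), symmetric]
    by (rule fun_mat_cong) (rule assms(6))
qed (use assms(3-5) in \<open>auto simp: fun_mat_def\<close>)

text \<open>A strict inequality in one fibre would make the totals differ.\<close>

lemma card_fiber_eq:
  fixes f :: "'a \<Rightarrow> nat" and g :: "'b \<Rightarrow> nat"
  assumes fin: "finite A" "finite B" and "card A = card B"
    and le: "\<And>m. card {x \<in> A. f x = m} \<le> card {y \<in> B. g y = m}"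
  shows "card {x \<in> A. f x = m} = card {y \<in> B. g y = m}"
proof (rule ccontr)
  assume "card {x \<in> A. f x = m} \<noteq> card {y \<in> B. g y = m}"
  then have lt: "card {x \<in> A. f x = m} < card {y \<in> B. g y = m}" using le[of m] by simp
  define S where "S = f ` A \<union> g ` B"
  have S: "finite S" "f ` A \<subseteq> S" "g ` B \<subseteq> S" using fin by (auto simp: S_def)
  have "m \<in> S"
  proof (rule ccontr)
    assume "m \<notin> S"
    then have "{y \<in> B. g y = m} = {}" by (auto simp: S_def)
    then show False using lt by (simp only: card.empty not_less_zero)
  qed
  have "card A = (\<Sum>m\<in>S. card {x \<in> A. f x = m})"
    using sum.group[OF fin(1) S(1,2), of "\<lambda>_. 1::nat"] by simp
  also have "\<dots> < (\<Sum>m\<in>S. card {y \<in> B. g y = m})"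
    using S(1) le lt \<open>m \<in> S\<close> by (intro sum_strict_mono_ex1) auto
  also have "\<dots> = card B"
    using sum.group[OF fin(2) S(1,3), of "\<lambda>_. 1::nat"] by simp
  finally show False using assms(3) by simp
qed

section \<open>Raising and lowering of exponent vectors\<close>

definition level :: "nat \<Rightarrow> nat \<Rightarrow> (nat \<Rightarrow> nat) set" where
  "level n m = {a \<in> staircase n. (\<Sum>q<n. a q) = m}"

text \<open>Raising \<open>a q = q\<close> leaves the staircase, so such a term matches no
  \<open>b\<close> in a level.\<close>

definition staircase_up :: "nat \<Rightarrow> (nat \<Rightarrow> nat) \<Rightarrow> (nat \<Rightarrow> nat) \<Rightarrow> rat" where
  "staircase_up n a b = (\<Sum>q<n. if b = a(q := Suc (a q)) then of_nat (Suc (a q)) else 0)"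

text \<open>The coefficient is the raising coefficient with \<open>a q\<close> replaced by
  \<open>q - a q\<close>; it makes coordinate \<open>q\<close> an irreducible sl2-module of
  dimension \<open>q + 1\<close>.\<close>

definition staircase_down :: "nat \<Rightarrow> (nat \<Rightarrow> nat) \<Rightarrow> (nat \<Rightarrow> nat) \<Rightarrow> rat" where
  "staircase_down n a b =
    (\<Sum>q<n. if 0 < a q \<and> b = a(q := a q - 1) then of_nat (Suc q - a q) else 0)"

lemma finite_staircase: "finite (staircase n)"
  unfolding staircase_def by (intro finite_PiE) auto

lemma card_staircase: "card (staircase n) = fact n"
  unfolding staircase_def by (simp add: card_PiE fact_prod_Suc atLeast0LessThan)

lemma staircase_le: "a \<in> staircase n \<Longrightarrow> q < n \<Longrightarrow> a q \<le> q"
  by (auto simp: staircase_def)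

lemma staircase_fun_upd_iff:
  "a \<in> staircase n \<Longrightarrow> q < n \<Longrightarrow> a(q := x) \<in> staircase n \<longleftrightarrow> x \<le> q"
  by (auto simp: staircase_def PiE_iff extensional_def)

lemma staircase_ext: "a \<in> staircase n \<Longrightarrow> b \<in> staircase n \<Longrightarrow> (\<And>q. q < n \<Longrightarrow> a q = b q) \<Longrightarrow> a = b"
  unfolding staircase_def by (rule PiE_ext) auto

lemma finite_level: "finite (level n m)"
  unfolding level_def using finite_staircase by simp

lemma sum_fun_upd:
  fixes a :: "'a \<Rightarrow> nat"
  assumes "finite A" "q \<in> A"
  shows "(\<Sum>r\<in>A. (a(q := x)) r) + a q = (\<Sum>r\<in>A. a r) + x"
proof -
  have "(\<Sum>r\<in>A - {q}. (a(q := x)) r) = (\<Sum>r\<in>A - {q}. a r)"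
    by (intro sum.cong) auto
  then show ?thesis
    using sum.remove[OF assms, of "a(q := x)"] sum.remove[OF assms, of a] by (simp only: fun_upd_same)
qed

lemma level_Suc_upd:
  assumes "a \<in> level n m" "q < n"
  shows "a(q := Suc (a q)) \<in> level n (Suc m) \<longleftrightarrow> a q < q"
proof -
  have "(\<Sum>r<n. (a(q := Suc (a q))) r) = Suc m"
    using sum_fun_upd[of "{..<n}" q a "Suc (a q)"] assms by (simp add: level_def del: fun_upd_apply)
  then show ?thesis
    using assms by (simp add: level_def staircase_fun_upd_iff Suc_le_eq del: fun_upd_apply)
qed

lemma level_pred_upd:
  assumes "a \<in> level n m" "q < n" "0 < a q"
  shows "a(q := a q - 1) \<in> level n (m - 1)"
proof -
  have "(\<Sum>r<n. (a(q := a q - 1)) r) = m - 1"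
    using sum_fun_upd[of "{..<n}" q a "a q - 1"] assms by (simp add: level_def del: fun_upd_apply)
  moreover have "a q - 1 \<le> q"
    using assms staircase_le[of a n q] by (auto simp: level_def)
  ultimately show ?thesis
    using assms by (simp add: level_def staircase_fun_upd_iff del: fun_upd_apply)
qed

lemma sum_staircase_up:
  assumes a: "a \<in> level n m"
  shows "(\<Sum>b\<in>level n (Suc m). staircase_up n a b * g b) =
    (\<Sum>q<n. if a q < q then of_nat (Suc (a q)) * g (a(q := Suc (a q))) else 0)"
proof -
  have "(\<Sum>b\<in>level n (Suc m). staircase_up n a b * g b) =
      (\<Sum>q<n. \<Sum>b\<in>level n (Suc m). if b = a(q := Suc (a q)) then of_nat (Suc (a q)) * g b else 0)"
    unfolding staircase_up_def sum_distrib_right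
    by (subst sum.swap) (intro sum.cong refl, simp del: fun_upd_apply)
  also have "\<dots> = (\<Sum>q<n. if a q < q then of_nat (Suc (a q)) * g (a(q := Suc (a q))) else 0)"
    using level_Suc_upd[OF a] by (intro sum.cong refl) (simp add: finite_level del: fun_upd_apply)
  finally show ?thesis .
qed

lemma sum_staircase_down:
  assumes a: "a \<in> level n m"
  shows "(\<Sum>b\<in>level n (m - 1). staircase_down n a b * g b) =
    (\<Sum>q<n. if 0 < a q then of_nat (Suc q - a q) * g (a(q := a q - 1)) else 0)"
proof -
  have "(\<Sum>b\<in>level n (m - 1). staircase_down n a b * g b) =
      (\<Sum>q<n. \<Sum>b\<in>level n (m - 1). if 0 < a q \<and> b = a(q := a q - 1) then of_nat (Suc q - a q) * g b else 0)"
    unfolding staircase_down_def sum_distrib_right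
    by (subst sum.swap) (intro sum.cong refl, simp del: fun_upd_apply)
  also have "\<dots> = (\<Sum>q<n. if 0 < a q then of_nat (Suc q - a q) * g (a(q := a q - 1)) else 0)"
  proof (intro sum.cong refl)
    fix q assume "q \<in> {..<n}"
    then have "0 < a q \<Longrightarrow> a(q := a q - 1) \<in> level n (m - 1)"
      using level_pred_upd[OF a] by simp
    then show "(\<Sum>b\<in>level n (m - 1). if 0 < a q \<and> b = a(q := a q - 1) then of_nat (Suc q - a q) * g b else 0) =
      (if 0 < a q then of_nat (Suc q - a q) * g (a(q := a q - 1)) else 0)"
      by (cases "0 < a q") (simp_all add: finite_level del: fun_upd_apply)
  qed
  finally show ?thesis .
qed

lemma choose_two_eq_sum: "n choose 2 = (\<Sum>q<n. q)"
  by (induction n) (auto simp: numeral_2_eq_2)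

text \<open>Changes in two different coordinates commute and cancel. In one coordinate,
  \<open>(a q + 1) * (q - a q) - (q + 1 - a q) * a q = q - 2 * a q\<close>, and the sum over
  \<open>q < n\<close> is \<open>n choose 2\<close> minus twice the degree. For \<open>m = 0\<close>
  the lowering term is zero, since no exponent is positive.\<close>

lemma staircase_commutator:
  assumes a: "a \<in> level n m" and c: "c \<in> level n m"
  shows "(\<Sum>b\<in>level n (Suc m). staircase_up n a b * staircase_down n b c) =
    (\<Sum>b\<in>level n (m - 1). staircase_down n a b * staircase_up n b c)
    + (if a = c then of_nat (n choose 2) - 2 * of_nat m else 0)"
proof -
  define t1 :: "nat \<Rightarrow> nat \<Rightarrow> rat" where
    "t1 q r = (if a q < q then of_nat (Suc (a q)) *
      (if 0 < (a(q := Suc (a q))) r \<and> c = (a(q := Suc (a q)))(r := (a(q := Suc (a q))) r - 1)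
       then of_nat (Suc r - (a(q := Suc (a q))) r) else 0) else 0)" for q r
  define t2 :: "nat \<Rightarrow> nat \<Rightarrow> rat" where
    "t2 q r = (if 0 < a r then of_nat (Suc r - a r) *
      (if c = (a(r := a r - 1))(q := Suc ((a(r := a r - 1)) q)) then of_nat (Suc ((a(r := a r - 1)) q)) else 0) else 0)" for q r
  have ac: "a \<in> staircase n" "c \<in> staircase n" using a c by (auto simp: level_def)
  have t: "t1 q r = t2 q r + (if r = q then if a = c then of_nat q - 2 * of_nat (a q) else 0 else 0)"
    if q: "q < n" and r: "r < n" for q r
  proof (cases "q = r")
    case True
    have le: "a q \<le> q" using staircase_le[OF ac(1) q] .
    have "t1 q q = (if a = c then of_nat (Suc (a q)) * (of_nat q - of_nat (a q)) else 0)"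
      using le by (auto simp: t1_def of_nat_diff)
    moreover have "t2 q q = (if a = c then (of_nat q + 1 - of_nat (a q)) * of_nat (a q) else 0)"
      using le by (auto simp: t2_def of_nat_diff)
    ultimately show ?thesis using True by (simp add: algebra_simps)
  next
    case False
    let ?d = "a(q := Suc (a q), r := a r - 1)"
    have twist: "a(r := a r - 1, q := Suc (a q)) = ?d"
      using False by (rule fun_upd_twist[symmetric])
    \<comment> \<open>Raising first presupposes \<open>a q < q\<close>; as \<open>c\<close> lies in
      the staircase, a match with \<open>c\<close> implies it.\<close>
    have "a q < q" if "c = ?d"
      using staircase_le[OF ac(2) q] False unfolding that by simp
    moreover have "t1 q r = (if a q < q \<and> 0 < a r \<and> c = ?d then of_nat (Suc (a q)) * of_nat (Suc r - a r) else 0)"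
      using False by (simp add: t1_def)
    moreover have "t2 q r = (if 0 < a r \<and> c = ?d then of_nat (Suc (a q)) * of_nat (Suc r - a r) else 0)"
      unfolding twist[symmetric] using False by (simp add: t2_def)
    ultimately show ?thesis using False by (cases "c = ?d") simp_all
  qed
  have "(\<Sum>b\<in>level n (Suc m). staircase_up n a b * staircase_down n b c) = (\<Sum>q<n. \<Sum>r<n. t1 q r)"
    unfolding sum_staircase_up[OF a] t1_def
    by (intro sum.cong refl) (simp add: staircase_down_def sum_distrib_left del: fun_upd_apply)
  also have "\<dots> = (\<Sum>q<n. \<Sum>r<n. t2 q r + (if r = q then if a = c then of_nat q - 2 * of_nat (a q) else 0 else 0))"
    using t by (intro sum.cong refl) auto
  also have "\<dots> = (\<Sum>q<n. \<Sum>r<n. t2 q r) + (\<Sum>q<n. if a = c then of_nat q - 2 * of_nat (a q) else 0)"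
    by (simp add: sum.distrib)
  also have "(\<Sum>q<n. \<Sum>r<n. t2 q r) = (\<Sum>b\<in>level n (m - 1). staircase_down n a b * staircase_up n b c)"
    unfolding sum_staircase_down[OF a] t2_def
    by (subst sum.swap, intro sum.cong refl) (simp add: staircase_up_def sum_distrib_left del: fun_upd_apply cong: if_cong)
  also have "(\<Sum>q<n. if a = c then of_nat q - 2 * of_nat (a q) else 0) =
      (if a = c then of_nat (n choose 2) - 2 * of_nat m else (0 :: rat))"
  proof -
    have "(\<Sum>q<n. of_nat q - 2 * of_nat (a q)) = of_nat (\<Sum>q<n. q) - 2 * (of_nat (\<Sum>q<n. a q) :: rat)"
      by (simp add: sum_subtractf sum_distrib_left)
    moreover have "(\<Sum>q<n. a q) = m" using a by (simp add: level_def)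
    ultimately have "(\<Sum>q<n. of_nat q - 2 * of_nat (a q)) = of_nat (n choose 2) - 2 * (of_nat m :: rat)"
      by (simp only: choose_two_eq_sum)
    then show ?thesis by (cases "a = c") simp_all
  qed
  finally show ?thesis .
qed

text \<open>The restriction keeps the value \<open>undefined\<close> outside \<open>{..<n}\<close> required by \<open>PiE\<close>.\<close>

definition complement :: "nat \<Rightarrow> (nat \<Rightarrow> nat) \<Rightarrow> (nat \<Rightarrow> nat)" where
  "complement n a = (\<lambda>q\<in>{..<n}. q - a q)"

lemma complement_staircase: "complement n a \<in> staircase n"
  by (auto simp: complement_def staircase_def)

lemma complement_apply: "q < n \<Longrightarrow> complement n a q = q - a q"
  by (simp add: complement_def)

lemma complement_complement: "a \<in> staircase n \<Longrightarrow> complement n (complement n a) = a"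
  by (rule staircase_ext[of _ n]) (auto simp: complement_apply complement_staircase staircase_le)

lemma complement_level:
  assumes "a \<in> level n m"
  shows "complement n a \<in> level n ((n choose 2) - m)"
proof -
  have "(\<Sum>q<n. complement n a q) + (\<Sum>q<n. a q) = (\<Sum>q<n. q)"
    unfolding sum.distrib[symmetric]
    using assms by (intro sum.cong) (auto simp: complement_apply level_def staircase_le)
  then show ?thesis using assms complement_staircase[of n a]
    by (simp add: level_def choose_two_eq_sum)
qed

lemma card_level_symmetric:
  assumes "m \<le> n choose 2"
  shows "card (level n ((n choose 2) - m)) = card (level n m)"
proof (rule bij_betw_same_card)
  show "bij_betw (complement n) (level n ((n choose 2) - m)) (level n m)"
  proof (rule bij_betw_byWitness[where f' = "complement n"])
    show "complement n ` level n ((n choose 2) - m) \<subseteq> level n m"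
      using complement_level[of _ n "(n choose 2) - m"] assms by auto
    show "complement n ` level n m \<subseteq> level n ((n choose 2) - m)"
      using complement_level by blast
  qed (auto simp: level_def complement_complement)
qed

text \<open>Complementation reverses each coordinate, and
  \<open>Suc q - (q - a q) = Suc (a q)\<close> on the staircase, so lowering turns into raising with
  its coefficients.\<close>

lemma staircase_down_complement:
  assumes a: "a \<in> staircase n" and b: "b \<in> staircase n"
  shows "staircase_down n (complement n a) b = staircase_up n a (complement n b)"
  unfolding staircase_down_def staircase_up_def
proof (intro sum.cong refl)
  fix q assume "q \<in> {..<n}"
  then have q: "q < n" by simp
  let ?a = "complement n a" and ?b = "complement n b"
  have le: "a r \<le> r" "b r \<le> r" if "r < n" for r
    using that staircase_le a b by auto
  have "0 < ?a q \<and> b = ?a(q := ?a q - 1) \<longleftrightarrow> ?b = a(q := Suc (a q))"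
  proof
    assume *: "0 < ?a q \<and> b = ?a(q := ?a q - 1)"
    have b': "b r = (if r = q then q - a q - 1 else r - a r)" if "r < n" for r
      using * that q by (auto simp: complement_apply)
    have "a q < q" using * q by (simp add: complement_apply)
    then show "?b = a(q := Suc (a q))"
      using b' le q by (intro staircase_ext[of _ n])
        (auto simp: complement_staircase staircase_fun_upd_iff[OF a] complement_apply)
  next
    assume *: "?b = a(q := Suc (a q))"
    have a': "(if r = q then Suc (a q) else a r) = r - b r" if "r < n" for r
      using fun_cong[OF *, of r] that by (auto simp: complement_apply)
    have "Suc (a q) \<le> q" using a'[OF q] by simp
    then have "?a(q := ?a q - 1) \<in> staircase n"
      using q by (simp add: staircase_fun_upd_iff[OF complement_staircase] complement_apply)
    moreover have "b r = (?a(q := ?a q - 1)) r" if "r < n" for r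
      using a'[OF that] le[OF that] that by (auto simp: complement_apply split: if_splits)
    ultimately have "b = ?a(q := ?a q - 1)"
      using b by (intro staircase_ext[of _ n]) auto
    then show "0 < ?a q \<and> b = ?a(q := ?a q - 1)"
      using \<open>Suc (a q) \<le> q\<close> q by (simp add: complement_apply)
  qed
  moreover have "Suc q - ?a q = Suc (a q)" using le(1)[OF q] q by (simp add: complement_apply)
  ultimately show "(if 0 < ?a q \<and> b = ?a(q := ?a q - 1) then of_nat (Suc q - ?a q) else 0) =
      (if ?b = a(q := Suc (a q)) then of_nat (Suc (a q)) else (0 :: rat))"
    by simp
qed

section \<open>Comparison of the two bases\<close>

lemma weighted_op_apply: "weighted_op i p f v = (\<Sum>j<p. of_nat (Suc j) * nil_op (i + j) f v)"
  by (induction p) (simp_all add: fun_apply_simps)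

text \<open>Injectivity of \<open>u\<close> leaves at most one \<open>k\<close>, so the definite
  description becomes a sum, which can be interchanged with the sum over rows.\<close>

lemma weak_order_entry_eq:
  assumes "inj u"
  shows "weak_order_entry n u v = (\<Sum>k\<in>{1..<n}. if v = u \<circ> simple_transp k then of_nat k else 0)"
proof (cases "\<exists>k\<in>{1..<n}. v = u \<circ> simple_transp k")
  case True
  then obtain k where k: "k \<in> {1..<n}" "v = u \<circ> simple_transp k" by blast
  have eq: "v = u \<circ> simple_transp j \<longleftrightarrow> j = k" for j
    unfolding k(2) using inj_comp_simple_transp_eq_iff[OF assms, of j k] by auto
  have "(THE j. j \<in> {1..<n} \<and> v = u \<circ> simple_transp j) = k"
    using k(1) unfolding eq by (intro the_equality) auto
  then show ?thesis using True k(1) unfolding weak_order_entry_def eq by simp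
next
  case False
  then show ?thesis unfolding weak_order_entry_def by (auto intro!: sum.neutral)
qed

lemma sum_weak_order_entry:
  assumes v: "v \<in> perms_of_length n (Suc m)" and n: "n \<ge> 1"
  shows "(\<Sum>u\<in>perms_of_length n m. f u * weak_order_entry n u v) = weighted_op 1 (n - 1) f v"
proof -
  let ?W = "perms_of_length n m"
  have "(\<Sum>u\<in>?W. f u * weak_order_entry n u v) =
      (\<Sum>u\<in>?W. \<Sum>k\<in>{1..<n}. if u = v \<circ> simple_transp k then of_nat k * f u else 0)"
  proof (intro sum.cong refl)
    fix u assume "u \<in> ?W"
    then have "inj u" using permutes_inj by (auto simp: perms_of_length_def)
    have "v = u \<circ> simple_transp k \<longleftrightarrow> u = v \<circ> simple_transp k" for k
      by (metis comp_simple_transp_cancel)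
    then show "f u * weak_order_entry n u v = (\<Sum>k\<in>{1..<n}. if u = v \<circ> simple_transp k then of_nat k * f u else 0)"
      unfolding weak_order_entry_eq[OF \<open>inj u\<close>] sum_distrib_left by (intro sum.cong) auto
  qed
  also have "\<dots> = (\<Sum>k\<in>{1..<n}. if v \<circ> simple_transp k \<in> ?W then of_nat k * f (v \<circ> simple_transp k) else 0)"
    by (subst sum.swap) (simp add: finite_perms_of_length)
  also have "\<dots> = (\<Sum>k\<in>{1..<n}. of_nat k * nil_op k f v)"
  proof (intro sum.cong refl)
    fix k assume "k \<in> {1..<n}"
    then have k: "1 \<le> k" "k < n" by auto
    have inj: "inj v" using v permutes_inj by (auto simp: perms_of_length_def)
    show "(if v \<circ> simple_transp k \<in> ?W then of_nat k * f (v \<circ> simple_transp k) else 0) = of_nat k * nil_op k f v"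
    proof (cases "v (Suc k) < v k")
      case True
      then have "v \<circ> simple_transp k \<in> ?W" using perms_of_length_descent_iff[OF k True] v by simp
      then show ?thesis using True by (simp add: nil_op_def)
    next
      \<comment> \<open>At an ascent \<open>v \<circ> simple_transp k\<close> has length
        \<open>m + 2\<close>, so it indexes no row, in agreement with the value 0 of
        \<open>nil_op\<close>.\<close>
      case False
      then have "v k < v (Suc k)" using inj by (metis injD linorder_neqE_nat n_not_Suc_n)
      then have "v \<circ> simple_transp k \<in> perms_of_length n (Suc (Suc m))"
        using perms_of_length_descent_iff[OF k, of "v \<circ> simple_transp k" "Suc m"] v by simp
      then have "v \<circ> simple_transp k \<notin> ?W" by (simp add: perms_of_length_def)
      then show ?thesis using False by (simp add: nil_op_def)
    qed
  qed
  also have "\<dots> = (\<Sum>j<n - 1. of_nat (Suc j) * nil_op (1 + j) f v)"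
    by (rule sum.reindex_bij_witness[of _ Suc "\<lambda>k. k - 1"]) auto
  finally show ?thesis by (simp only: weighted_op_apply)
qed

lemma monom_image_eq_0:
  "r < q \<Longrightarrow> r < a r \<Longrightarrow> monom_image n q a = 0"
proof (induction q)
  case (Suc q)
  then show ?case by (cases "r = q") (simp_all add: elem_op_eq_0)
qed simp

text \<open>Expansion in monomial images turns the weak order matrix into the raising matrix of the
  staircase; this is the commuting square at one level.\<close>

lemma monom_image_intertwine:
  assumes a: "a \<in> level n m" and v: "v \<in> perms_of_length n (Suc m)" and n: "n \<ge> 1"
  shows "(\<Sum>u\<in>perms_of_length n m. monom_image n n a u * weak_order_entry n u v) =
    (\<Sum>b\<in>level n (Suc m). staircase_up n a b * monom_image n n b v)"
proof -
  have sum_apply: "(\<Sum>r\<in>A. g r) v = (\<Sum>r\<in>A. g r v)" for g :: "nat \<Rightarrow> perm_fun" and A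
    by (induction A rule: infinite_finite_induct) (simp_all add: fun_apply_simps)
  have eqs: "n - (n - 1) = 1" "Suc (n - 1) = n" "{..n - 1} = {..<n}" using n by auto
  have "(\<Sum>u\<in>perms_of_length n m. monom_image n n a u * weak_order_entry n u v) =
      (\<Sum>r<n. of_nat (Suc (a r)) * monom_image n n (a(r := Suc (a r))) v)"
    using weighted_op_monom_image[of "n - 1" n a] n
    unfolding sum_weak_order_entry[OF v n] eqs by (simp only: sum_apply scale_apply)
  \<comment> \<open>When \<open>a r = r\<close>, the raised exponent exceeds the number of factors
    of its \<open>elem_op\<close>, so the image vanishes.\<close>
  also have "\<dots> = (\<Sum>r<n. if a r < r then of_nat (Suc (a r)) * monom_image n n (a(r := Suc (a r))) v else 0)"
  proof (intro sum.cong refl)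
    fix r assume "r \<in> {..<n}"
    then have "\<not> a r < r \<Longrightarrow> monom_image n n (a(r := Suc (a r))) = 0"
      by (intro monom_image_eq_0[of r]) auto
    then show "of_nat (Suc (a r)) * monom_image n n (a(r := Suc (a r))) v =
      (if a r < r then of_nat (Suc (a r)) * monom_image n n (a(r := Suc (a r))) v else 0)"
      by (cases "a r < r") (simp_all add: zero_fun_apply del: fun_upd_apply)
  qed
  finally show ?thesis unfolding sum_staircase_up[OF a] .
qed

section \<open>Unimodularity of the change of basis\<close>

lemma point_eq_sum_monom_image:
  assumes "w \<in> perms_of_length n m"
  shows "\<exists>c :: (nat \<Rightarrow> nat) \<Rightarrow> int. \<forall>v\<in>perms_of_length n m.
    (\<Sum>a\<in>level n m. of_int (c a) * monom_image n n a v) = (if w = v then 1 else 0)"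
proof -
  have "point w \<in> int_span (monom_image n n ` staircase n)"
    using assms by (intro point_in_span_monom_image) (auto simp: perms_of_length_def)
  then obtain c :: "(nat \<Rightarrow> nat) \<Rightarrow> int"
    where c: "\<And>v. point w v = (\<Sum>a\<in>staircase n. of_int (c a) * monom_image n n a v)"
    using int_span_coefficients[OF _ finite_staircase] by blast
  have "(\<Sum>a\<in>level n m. of_int (c a) * monom_image n n a v) = (if w = v then 1 else 0)"
    if v: "v \<in> perms_of_length n m" for v
  proof -
    \<comment> \<open>Monomials of another degree are supported on permutations of another
      length.\<close>
    have "monom_image n n a v = 0" if "a \<in> staircase n - level n m" for a
      using monom_image_support[of n n a v] v that
      by (cases "monom_image n n a v = 0") (auto simp: level_def perms_of_length_def)
    then have "(\<Sum>a\<in>level n m. of_int (c a) * monom_image n n a v) = point w v"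
      unfolding c using finite_staircase by (intro sum.mono_neutral_left) (auto simp: level_def)
    then show ?thesis by (simp add: point_def)
  qed
  then show ?thesis by blast
qed

lemma point_coefficients:
  obtains c :: "(nat \<Rightarrow> nat) \<Rightarrow> (nat \<Rightarrow> nat) \<Rightarrow> int"
  where "\<And>w v. w \<in> perms_of_length n m \<Longrightarrow> v \<in> perms_of_length n m \<Longrightarrow>
    (\<Sum>a\<in>level n m. of_int (c w a) * monom_image n n a v) = (if w = v then 1 else 0)"
  using point_eq_sum_monom_image[of _ n m] by metis

text \<open>The integer coefficients give a one-sided inverse and hence an inequality at each level.
  Both families add up to \<open>fact n\<close>, which forces equality and makes the change of basis
  matrices square.\<close>

lemma card_perms_of_length_eq_card_level: "card (perms_of_length n m) = card (level n m)"
proof -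
  have le: "card (perms_of_length n m) \<le> card (level n m)" for m
  proof -
    obtain xs where xs: "distinct xs" "set xs = level n m"
      using finite_distinct_list[OF finite_level] by blast
    obtain ws where ws: "distinct ws" "set ws = perms_of_length n m"
      using finite_distinct_list[OF finite_perms_of_length] by blast
    obtain c :: "(nat \<Rightarrow> nat) \<Rightarrow> (nat \<Rightarrow> nat) \<Rightarrow> int" where
      c: "\<And>w v. w \<in> perms_of_length n m \<Longrightarrow> v \<in> perms_of_length n m \<Longrightarrow>
        (\<Sum>a\<in>level n m. of_int (c w a) * monom_image n n a v) = (if w = v then 1 else 0)"
      using point_coefficients[of n m] by metis
    have "fun_mat ws xs (\<lambda>w a. of_int (c w a)) * fun_mat xs ws (monom_image n n) = 1\<^sub>m (length ws)"
      unfolding fun_mat_mult[OF xs(1)] fun_mat_one[OF ws(1), symmetric]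
      by (rule fun_mat_cong) (simp add: xs ws c)
    then have "length ws \<le> length xs"
      by (rule left_inverse_dim_le[OF fun_mat_carrier fun_mat_carrier])
    then show ?thesis by (simp add: distinct_card[symmetric] xs ws flip: xs(2) ws(2))
  qed
  have sets: "perms_of_length n m = {w \<in> {w. w permutes {1..n}}. coxeter_length n w = m}"
    "level n m = {a \<in> staircase n. (\<Sum>q<n. a q) = m}" for m
    by (auto simp: perms_of_length_def level_def)
  show ?thesis
    unfolding sets
    by (rule card_fiber_eq[OF _ finite_staircase _ le[unfolded sets]])
      (simp_all add: finite_permutations card_staircase card_permutations)
qed

lemma det_monom_image_unimodular:
  assumes "distinct xs" "set xs = level n m" "distinct ws" "set ws = perms_of_length n m"
  shows "det (fun_mat xs ws (monom_image n n)) = 1 \<or> det (fun_mat xs ws (monom_image n n)) = - 1"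
proof -
  obtain c :: "(nat \<Rightarrow> nat) \<Rightarrow> (nat \<Rightarrow> nat) \<Rightarrow> int" where
    c: "\<And>w v. w \<in> perms_of_length n m \<Longrightarrow> v \<in> perms_of_length n m \<Longrightarrow>
      (\<Sum>a\<in>level n m. of_int (c w a) * monom_image n n a v) = (if w = v then 1 else 0)"
    using point_coefficients[of n m] by metis
  have "length xs = length ws"
    using card_perms_of_length_eq_card_level[of n m] assms distinct_card by metis
  then show ?thesis
    using assms c by (intro det_fun_mat_unimodular[where G = "\<lambda>w a. of_int (c w a)"])
      (simp_all add: monom_image_Ints)
qed

lemma det_complement_unimodular:
  assumes m: "m \<le> n choose 2" and "distinct xs" "set xs = level n m"
    and "distinct ys" "set ys = level n ((n choose 2) - m)"
  defines "J \<equiv> \<lambda>a b. if b = complement n a then 1 else (0 :: rat)"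
  shows "det (fun_mat xs ys J) = 1 \<or> det (fun_mat xs ys J) = - 1"
proof (rule det_fun_mat_unimodular)
  show "length xs = length ys"
    using card_level_symmetric[OF m] assms distinct_card by metis
  show "J x y \<in> \<int>" for x y by (simp add: J_def)
  show "J x y \<in> \<int>" for x y by (simp add: J_def)
  fix y y' assume "y \<in> set ys" "y' \<in> set ys"
  then have y: "y \<in> level n ((n choose 2) - m)" "y \<in> staircase n" "y' \<in> staircase n"
    using assms by (auto simp: level_def)
  have "complement n y \<in> level n m" using complement_level[OF y(1)] m by simp
  then show "(\<Sum>x\<in>set xs. J y x * J x y') = (if y = y' then 1 else 0)"
    using y by (simp add: assms(3) J_def if_distrib[of "\<lambda>t. t * _"] finite_level complement_complement cong: if_cong)
qed (use assms in auto)

lemma staircase_sl2_chain: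
  assumes c: "\<And>m. distinct (c m) \<and> set (c m) = level n m"
  shows "sl2_chain (\<lambda>m. fun_mat (c (m - 1)) (c m) (staircase_up n))
    (\<lambda>m. fun_mat (c m) (c (m - 1)) (staircase_down n)) (\<lambda>m. length (c m)) (n choose 2)"
proof
  fix m
  have dc: "distinct (c x)" "set (c x) = level n x" for x using c by auto
  have "fun_mat (c m) (c (Suc m)) (staircase_up n) * fun_mat (c (Suc m)) (c m) (staircase_down n) =
     fun_mat (c m) (c m) (\<lambda>x y. (\<Sum>b\<in>level n (m - 1). staircase_down n x b * staircase_up n b y)
       + (if x = y then of_nat (n choose 2) - 2 * of_nat m else 0))"
    unfolding fun_mat_mult[OF dc(1)] dc(2)
    by (rule fun_mat_cong) (simp only: dc staircase_commutator)
  also have "\<dots> = fun_mat (c m) (c (m - 1)) (staircase_down n) * fun_mat (c (m - 1)) (c m) (staircase_up n) +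
      (of_nat (n choose 2) - 2 * of_nat m) \<cdot>\<^sub>m 1\<^sub>m (length (c m))"
    using c by (simp add: fun_mat_add_scalar fun_mat_mult)
  finally show "fun_mat (c (Suc m - 1)) (c (Suc m)) (staircase_up n) * fun_mat (c (Suc m)) (c (Suc m - 1)) (staircase_down n) =
      fun_mat (c m) (c (m - 1)) (staircase_down n) * fun_mat (c (m - 1)) (c m) (staircase_up n) +
      (of_nat (n choose 2) - 2 * of_nat m) \<cdot>\<^sub>m 1\<^sub>m (length (c m))" by simp
  \<comment> \<open>In level 0 all exponents vanish and none can be lowered, which yields
    \<open>bottom\<close>.\<close>
  have "staircase_down n a b = 0" if "a \<in> level n 0" for a b
    using that unfolding staircase_down_def by (intro sum.neutral) (auto simp: level_def)
  then have "fun_mat (c 0) (c (0 - 1)) (staircase_down n) = 0\<^sub>m (length (c 0)) (length (c 0))"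
    using dc(2)[of 0] by (intro eq_matI) (auto simp: fun_mat_def dest: nth_mem)
  then show "fun_mat (c 0) (c (0 - 1)) (staircase_down n) * fun_mat (c (0 - 1)) (c 0) (staircase_up n) =
      0\<^sub>m (length (c 0)) (length (c 0))"
    by (simp add: left_mult_zero_mat[OF fun_mat_carrier])
qed auto

theorem theorem1p2:
  fixes n N l :: nat and e :: "nat \<Rightarrow> (nat \<Rightarrow> nat) list"
  assumes "n \<ge> 1"
    and "N = n choose 2"
    and "l \<le> N - l"
    and "l \<le> N"
    and "\<And>m. m \<le> N \<Longrightarrow> distinct (e m) \<and> set (e m) = perms_of_length n m"
  defines "P \<equiv> \<Prod>k=0..l. (\<Prod>j=l - k + 1..N - l - k. rat_of_nat j) powi
      (int (card (perms_of_length n k)) - (if k = 0 then 0 else int (card (perms_of_length n (k - 1)))))"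
  shows "det (weak_order_prod_mat n e l) = P \<or> det (weak_order_prod_mat n e l) = - P"
proof -
  define c where "c m = (SOME xs. distinct xs \<and> set xs = level n m)" for m
  have c: "distinct (c m) \<and> set (c m) = level n m" for m
    unfolding c_def by (rule someI_ex) (metis finite_distinct_list finite_level)
  define d where "d m = length (c m)" for m
  define r where "r = N - 2 * l"
  have r: "l + r = N - l" using assms(3,4) by (simp add: r_def)
  have le: "l + r \<le> N" by (simp add: r)
  have d_card: "d m = card (level n m)" for m
    using c distinct_card unfolding d_def by metis
  have length_e: "length (e m) = d m" if "m \<le> N" for m
    using assms(5)[OF that] distinct_card[of "e m"] by (simp add: d_card card_perms_of_length_eq_card_level)
  have d_sym: "d (N - m) = d m" if "m \<le> N" for m
    using card_level_symmetric[of m n] that by (simp add: d_card assms(2))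
  \<comment> \<open>Levels \<open>l\<close> and \<open>N - l\<close> have equal size, so the
    products compared below are square.\<close>
  have d_l: "d (l + r) = d l" using d_sym[OF assms(4)] by (simp add: r)

  define K where "K m = fun_mat (c (m - 1)) (c m) (staircase_up n)" for m
  define L where "L m = fun_mat (c m) (c (m - 1)) (staircase_down n)" for m
  define M where "M m = fun_mat (e (m - 1)) (e m) (weak_order_entry n)" for m
  define T where "T m = fun_mat (c m) (e m) (monom_image n n)" for m
  define J where "J m = fun_mat (c m) (c (N - m)) (\<lambda>a b. if b = complement n a then 1 else 0)" for m
  \<comment> \<open>Lowering from level \<open>N - m + 1\<close> to \<open>N - m\<close>, seen
    through complementation, is raising from \<open>m - 1\<close> to \<open>m\<close>.\<close>
  define L' where "L' m = L (Suc N - m)" for m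
  have K_carrier: "K m \<in> carrier_mat (d (m - 1)) (d m)" for m
    unfolding K_def d_def by simp
  have L_carrier: "L m \<in> carrier_mat (d m) (d (m - 1))" for m
    unfolding L_def d_def by simp
  have M_carrier: "M m \<in> carrier_mat (d (m - 1)) (d m)" if "m \<le> N" for m
    using fun_mat_carrier[of "e (m - 1)" "e m"] length_e[of m] length_e[of "m - 1"] that
    unfolding M_def by simp
  have T_carrier: "T m \<in> carrier_mat (d m) (d m)" if "m \<le> N" for m
    using fun_mat_carrier[of "c m" "e m"] length_e[OF that] unfolding T_def d_def[symmetric] by simp
  have J_carrier: "J m \<in> carrier_mat (d m) (d m)" if "m \<le> N" for m
    using fun_mat_carrier[of "c m" "c (N - m)"] d_sym[OF that] unfolding J_def d_def[symmetric] by simp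
  have L'_carrier: "L' m \<in> carrier_mat (d (m - 1)) (d m)" if "1 \<le> m" "m \<le> N" for m
  proof -
    have "Suc N - m = N - (m - 1)" "Suc N - m - 1 = N - m" using that by auto
    then show ?thesis
      using L_carrier[of "Suc N - m"] d_sym[of m] d_sym[of "m - 1"] that unfolding L'_def by simp
  qed

  have TM: "T (m - 1) * M m = K m * T m" if "1 \<le> m" "m \<le> N" for m
  proof -
    have e: "distinct (e (m - 1))" "set (e (m - 1)) = perms_of_length n (m - 1)"
        "set (e m) = perms_of_length n m"
      using assms(5)[of m] assms(5)[of "m - 1"] that by auto
    have cm: "distinct (c m)" "set (c m) = level n m" "set (c (m - 1)) = level n (m - 1)"
      using c by auto
    have "Suc (m - 1) = m" using that by simp
    then show ?thesis
      unfolding T_def M_def K_def fun_mat_mult[OF e(1)] fun_mat_mult[OF cm(1)] e(2) cm(2)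
      using monom_image_intertwine[of _ n "m - 1", OF _ _ assms(1)] e(3) cm(3)
      by (intro fun_mat_cong) simp
  qed
  have JL: "J (m - 1) * L' m = K m * J m" if "1 \<le> m" "m \<le> N" for m
  proof -
    have eq: "Suc N - m = N - (m - 1)" "N - (m - 1) - 1 = N - m" using that by auto
    have dc: "distinct (c x)" "set (c x) = level n x" for x using c by auto
    have "(\<Sum>y\<in>level n (N - (m - 1)). (if y = complement n a then 1 else 0) * staircase_down n y b) =
        (\<Sum>y\<in>level n m. staircase_up n a y * (if b = complement n y then 1 else 0))"
      if a: "a \<in> level n (m - 1)" and b: "b \<in> level n (N - m)" for a b
    proof -
      have st: "a \<in> staircase n" "b \<in> staircase n" using a b by (auto simp: level_def)
      have ca: "complement n a \<in> level n (N - (m - 1))"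
        using complement_level[OF a] by (simp add: assms(2))
      have cb: "complement n b \<in> level n m"
        using complement_level[OF b] \<open>m \<le> N\<close> by (simp add: assms(2))
      have "(\<Sum>y\<in>level n (N - (m - 1)). (if y = complement n a then 1 else 0) * staircase_down n y b) =
          (\<Sum>y\<in>level n (N - (m - 1)). if y = complement n a then staircase_down n y b else 0)"
        by (intro sum.cong) auto
      also have "\<dots> = staircase_down n (complement n a) b"
        using ca finite_level by simp
      also have "\<dots> = staircase_up n a (complement n b)"
        by (rule staircase_down_complement[OF st])
      also have "\<dots> = (\<Sum>y\<in>level n m. if y = complement n b then staircase_up n a y else 0)"
        using cb finite_level by simp
      also have "\<dots> = (\<Sum>y\<in>level n m. staircase_up n a y * (if b = complement n y then 1 else 0))"
        using complement_complement st(2) by (intro sum.cong) (auto simp: level_def)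
      finally show ?thesis .
    qed
    then show ?thesis
      unfolding J_def L'_def L_def K_def eq fun_mat_mult[OF dc(1)] dc(2)
      by (intro fun_mat_cong) (simp only: dc(2))
  qed

  define Mp where "Mp = up_prod M d l r"
  define Kp where "Kp = up_prod K d l r"
  define Lp where "Lp = down_prod L d l r"
  have Mp_carrier: "Mp \<in> carrier_mat (d l) (d l)"
    using up_prod_carrier[of l r M d] M_carrier le unfolding Mp_def d_l by simp
  have Kp_carrier: "Kp \<in> carrier_mat (d l) (d l)"
    using up_prod_carrier[of l r K d] K_carrier unfolding Kp_def d_l by simp
  have Lp_carrier: "Lp \<in> carrier_mat (d l) (d l)"
    using down_prod_carrier[of l r L d] L_carrier unfolding Lp_def d_l by simp
  have T_det: "det (T m) = 1 \<or> det (T m) = - 1" if "m \<le> N" for m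
    unfolding T_def using c assms(5)[OF that] by (intro det_monom_image_unimodular) auto
  have J_det: "det (J m) = 1 \<or> det (J m) = - 1" if "m \<le> N" for m
    unfolding J_def using c that assms(2) by (intro det_complement_unimodular) auto

  have "weak_order_prod_mat n e l = Mp"
  proof -
    have "foldr (\<lambda>m A. M m * A) [l + 1..<l + r + 1] (1\<^sub>m (d (l + r))) = Mp * 1\<^sub>m (d (l + r))"
      unfolding Mp_def by (rule foldr_eq_up_prod) (use M_carrier le in auto)
    moreover have "weak_order_mat n e = M"
      by (rule ext) (simp add: M_def weak_order_mat_def fun_mat_def)
    ultimately show ?thesis
      using Mp_carrier length_e[of "N - l"] d_l
      by (simp add: weak_order_prod_mat_def r flip: assms(2))
  qed
  moreover have "T l * Mp = Kp * T (l + r)"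
    unfolding Mp_def Kp_def
    by (rule up_prod_intertwine) (use M_carrier K_carrier T_carrier TM le in auto)
  then have "det (T l) * det Mp = det Kp * det (T (l + r))"
    using det_mult[OF T_carrier[OF assms(4)] Mp_carrier] det_mult[OF Kp_carrier, of "T (l + r)"]
      T_carrier[OF le] by (simp add: d_l)
  then have Mp_det: "det Mp = det Kp \<or> det Mp = - det Kp"
    using T_det[OF assms(4)] T_det[OF le] by auto
  moreover have "J l * Lp = Kp * J (l + r)"
  proof -
    have "2 * l + r = N" using r assms(4) by simp
    have "Lp = up_prod L' (\<lambda>m. d (N - m)) l r"
      unfolding Lp_def L'_def using down_prod_eq_up_prod[of l r L d] L_carrier \<open>2 * l + r = N\<close> by simp
    \<comment> \<open>The dimension function enters only through the empty product, and
      \<open>d (N - l) = d l\<close>.\<close>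
    also have "\<dots> = up_prod L' d l r"
    proof -
      have "up_prod L' (\<lambda>m. d (N - m)) l s = up_prod L' d l s" for s
        using d_sym[OF assms(4)] by (induction s) auto
      then show ?thesis .
    qed
    finally show ?thesis
      unfolding Kp_def
      using up_prod_intertwine[of l r L' d K J] L'_carrier K_carrier J_carrier JL le by simp
  qed
  then have "det (J l) * det Lp = det Kp * det (J (l + r))"
    using det_mult[OF J_carrier[OF assms(4)] Lp_carrier] det_mult[OF Kp_carrier, of "J (l + r)"]
      J_carrier[OF le] by (simp add: d_l)
  then have "det Lp = det Kp \<or> det Lp = - det Kp"
    using J_det[OF assms(4)] J_det[OF le] by auto
  moreover have "det Kp * det Lp = P\<^sup>2"
  proof -
    interpret sl2_chain K L d N
      using staircase_sl2_chain[of c n] c unfolding K_def[abs_def] L_def[abs_def] d_def[abs_def] assms(2) by blast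
    have "P = (\<Prod>k=0..l. (\<Prod>j=l - k + 1..N - l - k. rat_of_nat j) powi mult k)"
      unfolding P_def mult_def d_card card_perms_of_length_eq_card_level ..
    then show ?thesis
      using det_up_down_eq_square[OF r assms(4)] det_mult[OF Kp_carrier Lp_carrier]
      by (simp only: Kp_def Lp_def)
  qed
  then have "(det Kp)\<^sup>2 = P\<^sup>2"
  proof -
    assume KL: "det Kp * det Lp = P\<^sup>2"
    consider "det Lp = det Kp" | "det Lp = - det Kp" using \<open>det Lp = det Kp \<or> det Lp = - det Kp\<close> by blast
    then show ?thesis
    proof cases
      case 1
      then show ?thesis using KL by (simp add: power2_eq_square)
    next
      \<comment> \<open>Rational squares are nonnegative, so this sign is possible only if
        \<open>det Kp\<close> and \<open>P\<close> are both 0.\<close>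
      case 2
      then have "- (det Kp)\<^sup>2 = P\<^sup>2" using KL by (simp add: power2_eq_square)
      then have "(det Kp)\<^sup>2 + P\<^sup>2 = 0" by linarith
      then have "det Kp = 0 \<and> P = 0" by (simp only: sum_power2_eq_zero_iff)
      then show ?thesis by simp
    qed
  qed
  then have "det Kp = P \<or> det Kp = - P"
    by (simp only: power2_eq_iff)
  ultimately show ?thesis by auto
qed

end
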